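(* Let $K$ be a Krein space and let $\{f_n\}_{n\in\mathbb{N}}$ be a $J$-frame for $K$ with optimal bounds $B_2\le A_2<0<A_1\le B_1$ such that $f_n\ne 0$ for all $n\in\mathbb{N}$. If for every infinite increasing sequence $\{n_k\}\subset\mathbb{N}$, $\{f_{n_k}\}$ is a $J$-frame sequence with (the same) optimal bounds $B_2\le A_2<0<A_1\le B_1$, then $\{f_n\}$ is an exact $J$-frame.
   Context: A Krein space $(K,[\cdot,\cdot])$ is a vector space over $F=\mathbb{R}$ or $\mathbb{C}$ with a form $[\cdot,\cdot]$, linear in the first variable and satisfying $[y,x]=\overline{[x,y]}$, that admits a canonical decomposition $K=K^+[\dot{+}]K^-$ (direct, $[\cdot,\cdot]$-orthogonal) such that $(K^+,[\cdot,\cdot])$ and $(K^-,-[\cdot,\cdot])$ are Hilbert spaces. If $P^{\pm}$ are the projections of $K$ onto $K^{\pm}$ of this decomposition, the fundamental (canonical) symmetry is $J=P^+-P^-$, and $[x,y]_J=[x,Jy]$ is a Hilbert space inner product on $K$ with norm $\|\cdot\|_J$ (the associated Hilbert space). All topological notions refer to $\|\cdot\|_J$. A subspace $M$ is uniformly $J$-positive if there is $\epsilon>0$ with $[x,x]\ge\epsilon\|x\|_J^2$ for all $x\in M$, and uniformly $J$-negative if there is $\epsilon>0$ with $-[x,x]\ge\epsilon\|x\|_J^2$ for all $x\in M$. The subspace $\{0\}$ is both. "Maximal" means maximal under inclusion among subspaces with the given property. $J$-frame: let $\{f_i\}_{i\in I}$ ($I$ countable) be a Bessel sequence in $K$ (i.e.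 Bessel in the associated Hilbert space), with bounded synthesis operator $T:\ell^2(I)\to K$, $T(c_i)=\sum_i c_if_i$. Put $I_+=\{i:[f_i,f_i]\ge 0\}$, $I_-=\{i:[f_i,f_i]<0\}$, let $P_{\pm}$ be the orthogonal projection of $\ell^2(I)$ onto $\ell^2(I_{\pm})$, $T_{\pm}=TP_{\pm}$, and $M_{\pm}=\overline{\mathrm{span}}\{f_i:i\in I_{\pm}\}$. Then $\{f_i\}$ is a $J$-frame for $K$ if the range $R(T_+)$ is a maximal uniformly $J$-positive subspace of $K$ and $R(T_-)$ is a maximal uniformly $J$-negative subspace of $K$. A $J$-frame $\{f_n\}$ for $K$ is exact if the removal of an arbitrary $f_n$ leaves a collection that is no longer a $J$-frame for $K$. $J$-frame sequence: a Bessel sequence $\{h_i\}_{i\in I}$ in $K$ having no nonzero neutral elements (no $h_i\ne0$ with $[h_i,h_i]=0$) is a $J$-frame sequence for (in) $K$ if $\overline{\mathrm{span}}\{h_i:[h_i,h_i]>0\}$ is a uniformly $J$-positive subspace of $K$ and $\overline{\mathrm{span}}\{h_i:[h_i,h_i]<0\}$ is a uniformly $J$-negative subspace of $K$. Bounds: a $J$-frame or $J$-frame sequence $\{f_i\}_{i\in I}$, with $I_{\pm}$ and $M_{\pm}=\overline{\mathrm{span}}\{f_i:i\in I_{\pm}\}$, has bounds $B_2\le A_2<0<A_1\le B_1$ if $A_1[f,f]\le\sum_{i\in I_+}|[f,f_i]|^2\le B_1[f,f]$ for all $f\in M_+$ and $A_2[f,f]\le\sum_{i\in I_-}|[f,f_i]|^2\le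 B_2[f,f]$ for all $f\in M_-$. The bounds are optimal if $A_1$ and $|A_2|$ are the largest, and $B_1$ and $|B_2|$ the smallest, constants for which these inequalities hold. *)

theory Defs
  imports "HOL-Analysis.Analysis"
begin

text \<open>
  The scalar fields \<open>\<real>\<close> and \<open>\<complex>\<close> treated uniformly. The axioms leave no other possibility:
  \<open>conjg\<close> is an involutive automorphism whose fixed field is the image of the reals, so the
  field has degree at most 2 over the reals.
\<close>

class real_or_complex = real_normed_field +
  fixes conjg :: "'a \<Rightarrow> 'a" and re :: "'a \<Rightarrow> real"
  assumes conjg_add: "conjg (x + y) = conjg x + conjg y"
    and conjg_mult: "conjg (x * y) = conjg x * conjg y"
    and conjg_conjg: "conjg (conjg x) = x"
    and re_scaleR_one: "re x *\<^sub>R 1 = (x + conjg x) / 2"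
    and mult_conjg: "x * conjg x = (norm x)\<^sup>2 *\<^sub>R 1"

instantiation real :: real_or_complex
begin

definition conjg_real :: "real \<Rightarrow> real" where "conjg_real x = x"
definition re_real :: "real \<Rightarrow> real" where "re_real x = x"

instance
  by standard (auto simp: conjg_real_def re_real_def power2_eq_square)

end

instantiation complex :: real_or_complex
begin

definition conjg_complex :: "complex \<Rightarrow> complex" where "conjg_complex = cnj"
definition re_complex :: "complex \<Rightarrow> real" where "re_complex = Re"

instance
  by standard
    (auto simp: conjg_complex_def re_complex_def complex_add_cnj complex_norm_square
        scaleR_conv_of_real
      simp del: of_real_power)

end

text \<open>
  Since forms are Hermitian, \<open>form x x\<close> is a real scalar; \<open>re (form x x)\<close> is that real number.
\<close>

definition form_dist :: "('v::ab_group_add \<Rightarrow> 'v \<Rightarrow> 'k::real_or_complex) \<Rightarrow> 'v \<Rightarrow> 'v \<Rightarrow> real" where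
  "form_dist form x y = sqrt (re (form (x - y) (x - y)))"

definition hermitian_form ::
    "('k::real_or_complex \<Rightarrow> 'v::ab_group_add \<Rightarrow> 'v) \<Rightarrow> ('v \<Rightarrow> 'v \<Rightarrow> 'k) \<Rightarrow> bool" where
  "hermitian_form smul form \<longleftrightarrow>
     (\<forall>x y z. form (x + y) z = form x z + form y z) \<and>
     (\<forall>c x y. form (smul c x) y = c * form x y) \<and>
     (\<forall>x y. form y x = conjg (form x y))"

definition hilbert_subspace ::
    "('k::real_or_complex \<Rightarrow> 'v::ab_group_add \<Rightarrow> 'v) \<Rightarrow> ('v \<Rightarrow> 'v \<Rightarrow> 'k) \<Rightarrow> 'v set \<Rightarrow> bool" where
  "hilbert_subspace smul form S \<longleftrightarrow>
     module.subspace smul S \<and> (\<forall>x\<in>S. x \<noteq> 0 \<longrightarrow> 0 < re (form x x)) \<and>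
     Metric_space.mcomplete S (form_dist form)"

text \<open>
  A Krein space, whose underlying space is the whole type \<open>'v\<close>, together with a choice
  \<open>Kp\<close>, \<open>Km\<close> of canonical decomposition. A space with a Hermitian form is a Krein space iff
  such a choice exists; everything below that depends on \<open>J\<close> refers to the fixed choice.
\<close>

locale krein_space = vector_space smul
  for smul :: "'k::real_or_complex \<Rightarrow> 'v::ab_group_add \<Rightarrow> 'v" +
  fixes form :: "'v \<Rightarrow> 'v \<Rightarrow> 'k" and Kp Km :: "'v set"
  assumes hermitian: "hermitian_form smul form"
    and hilbert_Kp: "hilbert_subspace smul form Kp"
    and hilbert_Km: "hilbert_subspace smul (\<lambda>x y. - form x y) Km"
    and Kp_Km_orthogonal: "\<And>x y. x \<in> Kp \<Longrightarrow> y \<in> Km \<Longrightarrow> form x y = 0"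
    and Kp_Km_inter: "Kp \<inter> Km = {0}"
    and Kp_Km_sum: "\<And>x. \<exists>p\<in>Kp. \<exists>m\<in>Km. x = p + m"
begin

definition P_plus :: "'v \<Rightarrow> 'v" where
  "P_plus x = (THE p. p \<in> Kp \<and> x - p \<in> Km)"

definition P_minus :: "'v \<Rightarrow> 'v" where
  "P_minus x = (THE m. m \<in> Km \<and> x - m \<in> Kp)"

definition J :: "'v \<Rightarrow> 'v" where
  "J x = P_plus x - P_minus x"

definition J_inner :: "'v \<Rightarrow> 'v \<Rightarrow> 'k" where
  "J_inner x y = form x (J y)"

definition J_norm :: "'v \<Rightarrow> real" where
  "J_norm x = sqrt (re (J_inner x x))"

definition J_topology :: "'v topology" where
  "J_topology = Metric_space.mtopology UNIV (form_dist J_inner)"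

definition closed_span :: "'v set \<Rightarrow> 'v set" where
  "closed_span S = J_topology closure_of span S"

definition unif_J_positive :: "'v set \<Rightarrow> bool" where
  "unif_J_positive M \<longleftrightarrow>
     subspace M \<and> (\<exists>\<epsilon>>0. \<forall>x\<in>M. re (form x x) \<ge> \<epsilon> * (J_norm x)\<^sup>2)"

definition unif_J_negative :: "'v set \<Rightarrow> bool" where
  "unif_J_negative M \<longleftrightarrow>
     subspace M \<and> (\<exists>\<epsilon>>0. \<forall>x\<in>M. - re (form x x) \<ge> \<epsilon> * (J_norm x)\<^sup>2)"

definition max_unif_J_positive :: "'v set \<Rightarrow> bool" where
  "max_unif_J_positive M \<longleftrightarrow>
     unif_J_positive M \<and> (\<forall>N. unif_J_positive N \<and> M \<subseteq> N \<longrightarrow> N = M)"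

definition max_unif_J_negative :: "'v set \<Rightarrow> bool" where
  "max_unif_J_negative M \<longleftrightarrow>
     unif_J_negative M \<and> (\<forall>N. unif_J_negative N \<and> M \<subseteq> N \<longrightarrow> N = M)"

text \<open>
  A family is a function \<open>f\<close> with an explicit index set \<open>I\<close>, so that removing the member
  \<open>f n\<close> means passing from \<open>I\<close> to \<open>I - {n}\<close>.
\<close>

definition bessel :: "'i set \<Rightarrow> ('i \<Rightarrow> 'v) \<Rightarrow> bool" where
  "bessel I f \<longleftrightarrow> countable I \<and>
     (\<exists>B>0. \<forall>x. (\<lambda>i. (norm (J_inner x (f i)))\<^sup>2) summable_on I \<and>
        (\<Sum>\<^sub>\<infinity>i\<in>I. (norm (J_inner x (f i)))\<^sup>2) \<le> B * (J_norm x)\<^sup>2)"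

definition ell2 :: "'i set \<Rightarrow> ('i \<Rightarrow> 'k) set" where
  "ell2 I = {c. (\<forall>i. i \<notin> I \<longrightarrow> c i = 0) \<and> (\<lambda>i. (norm (c i))\<^sup>2) summable_on I}"

definition coord_proj :: "'i set \<Rightarrow> ('i \<Rightarrow> 'k) \<Rightarrow> 'i \<Rightarrow> 'k" where
  "coord_proj S c = (\<lambda>i. if i \<in> S then c i else 0)"

text \<open>
  The synthesis operator, with its series converging unconditionally in the norm of \<open>J\<close>.
  It is only used for Bessel families, for which the limit exists for all \<open>c \<in> ell2 I\<close>.
\<close>

definition synthesis :: "'i set \<Rightarrow> ('i \<Rightarrow> 'v) \<Rightarrow> ('i \<Rightarrow> 'k) \<Rightarrow> 'v" where
  "synthesis I f c =
     (THE x. limitin J_topology (\<lambda>F. \<Sum>i\<in>F. smul (c i) (f i)) x (finite_subsets_at_top I))"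

definition I_plus :: "'i set \<Rightarrow> ('i \<Rightarrow> 'v) \<Rightarrow> 'i set" where
  "I_plus I f = {i\<in>I. re (form (f i) (f i)) \<ge> 0}"

definition I_minus :: "'i set \<Rightarrow> ('i \<Rightarrow> 'v) \<Rightarrow> 'i set" where
  "I_minus I f = {i\<in>I. re (form (f i) (f i)) < 0}"

definition M_plus :: "'i set \<Rightarrow> ('i \<Rightarrow> 'v) \<Rightarrow> 'v set" where
  "M_plus I f = closed_span (f ` I_plus I f)"

definition M_minus :: "'i set \<Rightarrow> ('i \<Rightarrow> 'v) \<Rightarrow> 'v set" where
  "M_minus I f = closed_span (f ` I_minus I f)"

definition T_plus :: "'i set \<Rightarrow> ('i \<Rightarrow> 'v) \<Rightarrow> ('i \<Rightarrow> 'k) \<Rightarrow> 'v" where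
  "T_plus I f c = synthesis I f (coord_proj (I_plus I f) c)"

definition T_minus :: "'i set \<Rightarrow> ('i \<Rightarrow> 'v) \<Rightarrow> ('i \<Rightarrow> 'k) \<Rightarrow> 'v" where
  "T_minus I f c = synthesis I f (coord_proj (I_minus I f) c)"

definition J_frame :: "'i set \<Rightarrow> ('i \<Rightarrow> 'v) \<Rightarrow> bool" where
  "J_frame I f \<longleftrightarrow> bessel I f \<and>
     max_unif_J_positive (T_plus I f ` ell2 I) \<and>
     max_unif_J_negative (T_minus I f ` ell2 I)"

definition exact_J_frame :: "'i set \<Rightarrow> ('i \<Rightarrow> 'v) \<Rightarrow> bool" where
  "exact_J_frame I f \<longleftrightarrow> J_frame I f \<and> (\<forall>n\<in>I. \<not> J_frame (I - {n}) f)"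

definition J_frame_sequence :: "'i set \<Rightarrow> ('i \<Rightarrow> 'v) \<Rightarrow> bool" where
  "J_frame_sequence I h \<longleftrightarrow> bessel I h \<and>
     \<not> (\<exists>i\<in>I. h i \<noteq> 0 \<and> form (h i) (h i) = 0) \<and>
     unif_J_positive (closed_span (h ` {i\<in>I. re (form (h i) (h i)) > 0})) \<and>
     unif_J_negative (closed_span (h ` {i\<in>I. re (form (h i) (h i)) < 0}))"

text \<open>
  The four frame inequalities. On the negative side \<open>form x x \<le> 0\<close>, so negative constants
  give nonnegative bounds.
\<close>

definition lower_plus :: "'i set \<Rightarrow> ('i \<Rightarrow> 'v) \<Rightarrow> real \<Rightarrow> bool" where
  "lower_plus I f a \<longleftrightarrow> (\<forall>x\<in>M_plus I f.
     a * re (form x x) \<le> (\<Sum>\<^sub>\<infinity>i\<in>I_plus I f. (norm (form x (f i)))\<^sup>2))"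

definition upper_plus :: "'i set \<Rightarrow> ('i \<Rightarrow> 'v) \<Rightarrow> real \<Rightarrow> bool" where
  "upper_plus I f b \<longleftrightarrow> (\<forall>x\<in>M_plus I f.
     (\<Sum>\<^sub>\<infinity>i\<in>I_plus I f. (norm (form x (f i)))\<^sup>2) \<le> b * re (form x x))"

definition lower_minus :: "'i set \<Rightarrow> ('i \<Rightarrow> 'v) \<Rightarrow> real \<Rightarrow> bool" where
  "lower_minus I f a \<longleftrightarrow> (\<forall>x\<in>M_minus I f.
     a * re (form x x) \<le> (\<Sum>\<^sub>\<infinity>i\<in>I_minus I f. (norm (form x (f i)))\<^sup>2))"

definition upper_minus :: "'i set \<Rightarrow> ('i \<Rightarrow> 'v) \<Rightarrow> real \<Rightarrow> bool" where
  "upper_minus I f b \<longleftrightarrow> (\<forall>x\<in>M_minus I f.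
     (\<Sum>\<^sub>\<infinity>i\<in>I_minus I f. (norm (form x (f i)))\<^sup>2) \<le> b * re (form x x))"

definition has_J_bounds ::
    "'i set \<Rightarrow> ('i \<Rightarrow> 'v) \<Rightarrow> real \<Rightarrow> real \<Rightarrow> real \<Rightarrow> real \<Rightarrow> bool" where
  "has_J_bounds I f B2 A2 A1 B1 \<longleftrightarrow>
     B2 \<le> A2 \<and> A2 < 0 \<and> 0 < A1 \<and> A1 \<le> B1 \<and>
     lower_plus I f A1 \<and> upper_plus I f B1 \<and> lower_minus I f A2 \<and> upper_minus I f B2"

text \<open>
  Optimality compares with constants of the sign prescribed for bounds. On a side where
  \<open>M_plus\<close> or \<open>M_minus\<close> is \<open>{0}\<close> the inequalities hold for all constants and there is no
  extremal one; optimality then imposes nothing on that side. This case cannot be dismissed: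
  a sequence has subsequences lying entirely on one side.
\<close>

definition optimal_J_bounds ::
    "'i set \<Rightarrow> ('i \<Rightarrow> 'v) \<Rightarrow> real \<Rightarrow> real \<Rightarrow> real \<Rightarrow> real \<Rightarrow> bool" where
  "optimal_J_bounds I f B2 A2 A1 B1 \<longleftrightarrow> has_J_bounds I f B2 A2 A1 B1 \<and>
     (M_plus I f \<noteq> {0} \<longrightarrow>
        (\<forall>a>0. lower_plus I f a \<longrightarrow> a \<le> A1) \<and> (\<forall>b>0. upper_plus I f b \<longrightarrow> B1 \<le> b)) \<and>
     (M_minus I f \<noteq> {0} \<longrightarrow>
        (\<forall>a<0. lower_minus I f a \<longrightarrow> \<bar>a\<bar> \<le> \<bar>A2\<bar>) \<and> (\<forall>b<0. upper_minus I f b \<longrightarrow> \<bar>B2\<bar> \<le> \<bar>b\<bar>))"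

end

end

theory Submission
  imports Defs
begin

text \<open>
  The positive and the negative members are treated separately; on each side the closed span is
  an inner product space for \<open>\<plusminus>[\<cdot>,\<cdot>]\<close>, say with bounds \<open>a \<le> b\<close> and members \<open>f i\<close>, \<open>i \<in> P\<close>.
  Applying the lower bound to \<open>f m\<close> and a subsequence that avoids the other members correlated
  with \<open>f m\<close>, and the upper bound to \<open>f m\<close>, gives \<open>a \<le> [f m, f m] \<le> b\<close>. If \<open>P\<close> is infinite, the
  members tend weakly to zero, so some subsequence has Gram matrix arbitrarily close to
  \<open>\<alpha>\<close> times the identity; its optimal bounds are close to \<open>\<alpha>\<close>, but they are \<open>a\<close> and \<open>b\<close>, hence
  \<open>a = b\<close>. If \<open>P\<close> is finite, the subsequence consisting of \<open>f m\<close> and the members of the other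
  side does the same. Now \<open>[f m, f m] = a\<close> exhausts the frame inequality at \<open>f m\<close>, so the
  members are orthogonal. If the family without \<open>f n\<close> were still a \<open>J\<close>-frame, maximality would
  put \<open>f n\<close> in the closed span of the remaining members of its side, to which it is orthogonal.
\<close>

section \<open>Scalars\<close>

lemma of_real_re: "of_real (re z) = (z + conjg z) / (2 :: 'k::real_or_complex)"
  using re_scaleR_one[of z] by (simp add: of_real_def)

lemma conjg_0 [simp]: "conjg 0 = (0::'k::real_or_complex)"
  using conjg_add[of 0 "0::'k"] by simp

lemma conjg_1 [simp]: "conjg 1 = (1::'k::real_or_complex)"
proof -
  have "conjg 1 \<noteq> (0::'k)" by (metis conjg_0 conjg_conjg zero_neq_one)
  moreover have "conjg 1 * conjg 1 = (conjg 1 :: 'k)"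
    using conjg_mult[of 1 "1::'k"] by simp
  ultimately show ?thesis by simp
qed

lemma conjg_minus: "conjg (- z) = - conjg (z::'k::real_or_complex)"
  using conjg_add[of z "- z"] by (simp add: eq_neg_iff_add_eq_0 add.commute)

lemma conjg_diff: "conjg (x - y) = conjg x - conjg (y::'k::real_or_complex)"
  using conjg_add[of x "- y"] by (simp add: conjg_minus)

text \<open>For \<open>t\<close> >= 0 the scalar \<open>t\<close> equals \<open>s * conjg s\<close>
  with \<open>s\<close> the square root of \<open>t\<close>, and \<open>conjg\<close> only swaps
  these two factors. Negative reals follow by changing the sign.\<close>

lemma conjg_of_real [simp]: "conjg (of_real r) = (of_real r :: 'k::real_or_complex)"
proof -
  have nonneg: "conjg (of_real t) = (of_real t :: 'k)" if "t \<ge> 0" for t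
  proof -
    have "of_real (sqrt t) * conjg (of_real (sqrt t)) = (of_real t :: 'k)"
      using mult_conjg[of "of_real (sqrt t) :: 'k"] that by (simp add: of_real_def)
    then show ?thesis
      by (metis conjg_conjg conjg_mult mult.commute)
  qed
  show ?thesis
    using nonneg[of r] nonneg[of "- r"] by (cases "r \<ge> 0") (auto simp: conjg_minus)
qed

lemma re_of_real [simp]: "re (of_real r :: 'k::real_or_complex) = r"
proof -
  have "of_real (re (of_real r :: 'k)) = (of_real r :: 'k)"
    by (simp add: of_real_re)
  then show ?thesis by (simp only: of_real_eq_iff)
qed

lemma re_add: "re (x + y) = re x + re (y::'k::real_or_complex)"
proof -
  have "(of_real (re (x + y)) :: 'k) = of_real (re x + re y)"
    by (simp add: of_real_re conjg_add add_divide_distrib)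
  then show ?thesis by (simp only: of_real_eq_iff)
qed

lemma re_0 [simp]: "re (0::'k::real_or_complex) = 0"
  using re_of_real[of 0] by simp

lemma re_minus: "re (- x) = - re (x::'k::real_or_complex)"
  using re_add[of x "- x"] by simp

lemma re_diff: "re (x - y) = re x - re (y::'k::real_or_complex)"
  using re_add[of x "- y"] by (simp add: re_minus)

lemma re_conjg [simp]: "re (conjg x) = re (x::'k::real_or_complex)"
proof -
  have "(of_real (re (conjg x)) :: 'k) = of_real (re x)"
    by (simp add: of_real_re conjg_conjg add.commute)
  then show ?thesis by (simp only: of_real_eq_iff)
qed

lemma re_sum: "re (\<Sum>i\<in>F. z i) = (\<Sum>i\<in>F. re (z i :: 'k::real_or_complex))"
  by (induction F rule: infinite_finite_induct) (auto simp: re_add)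

lemma norm_conjg [simp]: "norm (conjg x) = norm (x::'k::real_or_complex)"
proof (cases "x = 0")
  case False
  have "norm x * norm (conjg x) = norm x * norm x"
    using arg_cong[OF mult_conjg[of x], of norm] by (simp add: norm_mult power2_eq_square)
  then show ?thesis using False by simp
qed auto

lemma mult_conjg_of_real: "x * conjg x = of_real ((norm x)\<^sup>2)" for x :: "'k::real_or_complex"
  using mult_conjg[of x] by (simp add: of_real_def)

lemma abs_re_le_norm: "\<bar>re x\<bar> \<le> norm (x::'k::real_or_complex)"
proof -
  have "\<bar>re x\<bar> = norm (x + conjg x) / 2"
    using arg_cong[OF of_real_re[of x], of norm] by (simp add: norm_divide)
  also have "\<dots> \<le> norm x" using norm_triangle_ineq[of x "conjg x"] by simp
  finally show ?thesis .
qed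

section \<open>Hermitian forms\<close>

locale hermitian_space = vector_space smul
  for smul :: "'k::real_or_complex \<Rightarrow> 'v::ab_group_add \<Rightarrow> 'v" +
  fixes g :: "'v \<Rightarrow> 'v \<Rightarrow> 'k"
  assumes herm: "hermitian_form smul g"
begin

definition q :: "'v \<Rightarrow> real" where "q x = re (g x x)"

lemma g_add_left: "g (x + y) z = g x z + g y z"
  and g_smul_left: "g (smul c x) y = c * g x y"
  and g_conj: "g y x = conjg (g x y)"
  using herm unfolding hermitian_form_def by blast+

lemma g_add_right: "g x (y + z) = g x y + g x z"
  by (metis g_conj g_add_left conjg_add)

lemma g_smul_right: "g x (smul c y) = conjg c * g x y"
  by (metis g_conj g_smul_left conjg_mult)

lemma g_zero_left [simp]: "g 0 y = 0"
  using g_add_left[of 0 0 y] by simp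

lemma g_zero_right [simp]: "g y 0 = 0"
  using g_add_right[of y 0 0] by simp

lemma g_minus_left: "g (- x) y = - g x y"
  using g_add_left[of x "- x" y] by (simp add: eq_neg_iff_add_eq_0 add.commute)

lemma g_minus_right: "g x (- y) = - g x y"
  using g_add_right[of x y "- y"] by (simp add: eq_neg_iff_add_eq_0 add.commute)

lemma g_diff_left: "g (x - y) z = g x z - g y z"
  using g_add_left[of x "- y" z] by (simp add: g_minus_left)

lemma g_diff_right: "g x (y - z) = g x y - g x z"
  using g_add_right[of x y "- z"] by (simp add: g_minus_right)

lemma g_sum_left: "g (\<Sum>i\<in>F. x i) y = (\<Sum>i\<in>F. g (x i) y)"
  by (induction F rule: infinite_finite_induct) (auto simp: g_add_left)

lemma g_sum_right: "g y (\<Sum>i\<in>F. x i) = (\<Sum>i\<in>F. g y (x i))"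
  by (induction F rule: infinite_finite_induct) (auto simp: g_add_right)

lemma g_self: "g x x = of_real (q x)"
  using of_real_re[of "g x x"] g_conj[of x x] by (simp add: q_def)

lemma norm_g_self: "norm (g x x) = \<bar>q x\<bar>"
  by (simp add: g_self)

lemma q_zero [simp]: "q 0 = 0"
  by (simp add: q_def)

lemma norm_g_sym: "norm (g x y) = norm (g y x)"
  by (metis g_conj norm_conjg)

lemma q_smul: "q (smul c x) = (norm c)\<^sup>2 * q x"
proof -
  have "g (smul c x) (smul c x) = (c * conjg c) * g x x"
    by (simp add: g_smul_left g_smul_right)
  also have "\<dots> = of_real ((norm c)\<^sup>2 * q x)"
    unfolding mult_conjg_of_real g_self by simp
  finally show ?thesis unfolding q_def[of "smul c x"] by (simp only: re_of_real)
qed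

lemma q_add: "q (x + y) = q x + 2 * re (g x y) + q y"
  using re_conjg[of "g x y"]
  by (simp add: q_def g_add_left g_add_right re_add g_conj[of y x])

lemma q_minus [simp]: "q (- x) = q x"
  by (simp add: q_def g_minus_left g_minus_right)

lemma q_diff_commute: "q (x - y) = q (y - x)"
  by (metis minus_diff_eq q_minus)

section \<open>Cauchy-Schwarz and the triangle inequality on positive definite subspaces\<close>

definition posdef_on :: "'v set \<Rightarrow> bool" where
  "posdef_on M \<longleftrightarrow> subspace M \<and> (\<forall>x\<in>M. x \<noteq> 0 \<longrightarrow> 0 < q x)"

context
  fixes M assumes M: "posdef_on M"
begin

lemma posdef_subspace: "subspace M"
  using M by (simp add: posdef_on_def)

lemma posdef_nonneg: "x \<in> M \<Longrightarrow> 0 \<le> q x"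
  using M unfolding posdef_on_def by (cases "x = 0") (auto intro: less_imp_le)

lemma Cauchy_Schwarz:
  assumes "x \<in> M" "y \<in> M"
  shows "(norm (g x y))\<^sup>2 \<le> q x * q y"
proof (cases "y = 0")
  case False
  then have pos: "0 < q y" using M assms by (auto simp: posdef_on_def)
  \<comment> \<open>The minimising coefficient: \<open>x + smul c y\<close> is the component of
    \<open>x\<close> orthogonal to \<open>y\<close>, and the claim is that its square is
    nonnegative.\<close>
  define c where "c = - (g x y / of_real (q y))"
  have "re (g x (smul c y)) = re (conjg c * g x y)" by (simp add: g_smul_right)
  also have "conjg c * g x y = - of_real ((norm (g x y))\<^sup>2 / q y)"
  proof -
    \<comment> \<open>Multiplicativity of \<open>conjg\<close> yields its quotient rule for a real
      denominator.\<close>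
    have "of_real (q y) * conjg (g x y / of_real (q y)) = conjg (g x y)"
      using pos conjg_mult[of "of_real (q y)" "g x y / of_real (q y)"] by simp
    then have "conjg (g x y / of_real (q y)) = conjg (g x y) / of_real (q y)"
      using pos by (simp add: field_simps)
    then show ?thesis
      using mult_conjg_of_real[of "g x y"] by (simp add: c_def conjg_minus mult.commute)
  qed
  finally have re: "re (g x (smul c y)) = - ((norm (g x y))\<^sup>2 / q y)"
    by (simp only: re_minus re_of_real)
  have "x + smul c y \<in> M"
    using assms posdef_subspace by (simp add: subspace_add subspace_scale)
  then have "0 \<le> q (x + smul c y)" by (rule posdef_nonneg)
  also have "\<dots> = q x - 2 * ((norm (g x y))\<^sup>2 / q y) + (norm (g x y) / q y)\<^sup>2 * q y"
    unfolding q_add re q_smul using pos by (simp add: c_def norm_divide)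
  also have "\<dots> = q x - (norm (g x y))\<^sup>2 / q y"
    using pos by (simp add: power2_eq_square field_simps)
  finally show ?thesis using pos by (simp add: field_simps)
qed auto

lemma sqrt_q_triangle:
  assumes "x \<in> M" "y \<in> M"
  shows "sqrt (q (x + y)) \<le> sqrt (q x) + sqrt (q y)"
proof (rule real_le_lsqrt)
  have "\<bar>re (g x y)\<bar> \<le> norm (g x y)" by (rule abs_re_le_norm)
  also have "\<dots> \<le> sqrt (q x * q y)"
    using Cauchy_Schwarz[OF assms] by (rule real_le_rsqrt)
  finally have "re (g x y) \<le> sqrt (q x) * sqrt (q y)" by (simp add: real_sqrt_mult)
  then show "q (x + y) \<le> (sqrt (q x) + sqrt (q y))\<^sup>2"
    using assms by (simp add: q_add power2_sum posdef_nonneg)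
qed (use assms in \<open>auto simp: posdef_nonneg\<close>)

lemma sqrt_q_triangle_diff:
  assumes "x \<in> M" "y \<in> M"
  shows "sqrt (q x) \<le> sqrt (q y) + sqrt (q (x - y))"
  using sqrt_q_triangle[of y "x - y"] assms posdef_subspace by (simp add: subspace_diff)

end

section \<open>From bounds on finite linear combinations to frame inequalities\<close>

lemma span_image_sum:
  assumes "x \<in> span (f ` Q)"
  obtains F c where "finite F" "F \<subseteq> Q" "x = (\<Sum>i\<in>F. smul (c i) (f i))"
proof -
  obtain t r where t: "finite t" "t \<subseteq> f ` Q" "x = (\<Sum>a\<in>t. smul (r a) a)"
    using assms unfolding span_explicit by blast
  \<comment> \<open>The family \<open>f\<close> may repeat vectors; \<open>F\<close> selects one
    index for each vector that occurs.\<close>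
  obtain F where F: "F \<subseteq> Q" "inj_on f F" "t = f ` F"
    using t(2) by (auto simp: subset_image_inj)
  show thesis
    by (rule that[of F "r \<circ> f"]) (use t F in \<open>auto simp: sum.reindex finite_image_iff\<close>)
qed

lemma q_sum:
  "q (\<Sum>i\<in>F. smul (c i) (f i)) = (\<Sum>i\<in>F. \<Sum>j\<in>F. re (c i * conjg (c j) * g (f i) (f j)))"
  unfolding q_def g_sum_left
  by (simp add: g_sum_right g_smul_left g_smul_right re_sum sum_distrib_left mult_ac)

text \<open>For a synthesis operator \<open>T\<close> on a finite set of indices, \<open>L\<close> and \<open>U\<close> bound
  \<open>T\<^sup>* T\<close>; the conclusion bounds \<open>T T\<^sup>*\<close>.\<close>

lemma analysis_upper_finite:
  assumes M: "posdef_on M" and x: "x \<in> M" and f: "f ` F \<subseteq> M" and "0 \<le> U"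
    and U: "\<And>c. q (\<Sum>i\<in>F. smul (c i) (f i)) \<le> U * (\<Sum>i\<in>F. (norm (c i))\<^sup>2)"
  shows "(\<Sum>i\<in>F. (norm (g x (f i)))\<^sup>2) \<le> U * q x"
proof -
  define s where "s = (\<Sum>i\<in>F. (norm (g x (f i)))\<^sup>2)"
  \<comment> \<open>The frame operator applied to \<open>x\<close>. Pairing it with \<open>x\<close>
    gives \<open>s\<close>, while \<open>U\<close> bounds \<open>q z\<close> by
    \<open>U * s\<close>, so Cauchy-Schwarz leaves one factor \<open>s\<close> to cancel.\<close>
  define z where "z = (\<Sum>i\<in>F. smul (g x (f i)) (f i))"
  have z: "z \<in> M"
    using f posdef_subspace[OF M] unfolding z_def
    by (intro subspace_sum) (auto intro: subspace_scale)
  have "g x z = of_real s"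
    by (simp add: z_def s_def g_sum_right g_smul_right mult.commute mult_conjg_of_real
        del: of_real_power)
  then have "s\<^sup>2 \<le> q x * q z"
    using Cauchy_Schwarz[OF M x z] by simp
  also have "\<dots> \<le> q x * (U * s)"
    using U posdef_nonneg[OF M x] by (intro mult_left_mono) (auto simp: z_def s_def)
  finally have le: "s * s \<le> (U * q x) * s" by (simp add: power2_eq_square mult_ac)
  have "0 \<le> s" by (simp add: s_def sum_nonneg)
  show ?thesis
    using le \<open>0 \<le> s\<close> \<open>0 \<le> U\<close> posdef_nonneg[OF M x]
    by (cases "s = 0") (auto simp: s_def[symmetric])
qed

text \<open>Expanding one argument of \<open>g x x\<close> in the coefficients \<open>c\<close> and
  applying Cauchy-Schwarz to the sum bounds the square of \<open>q x\<close> by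
  \<open>C * s\<close>. The hypothesis on \<open>L\<close> trades \<open>C\<close> for
  \<open>q x\<close>, one factor of which cancels.\<close>

lemma analysis_lower_finite:
  assumes M: "posdef_on M" and x: "x \<in> M" "x = (\<Sum>i\<in>F. smul (c i) (f i))"
    and "0 \<le> L" and L: "L * (\<Sum>i\<in>F. (norm (c i))\<^sup>2) \<le> q x"
  shows "L * q x \<le> (\<Sum>i\<in>F. (norm (g x (f i)))\<^sup>2)"
proof -
  define s where "s = (\<Sum>i\<in>F. (norm (g x (f i)))\<^sup>2)"
  define C where "C = (\<Sum>i\<in>F. (norm (c i))\<^sup>2)"
  have s: "0 \<le> s" by (simp add: s_def sum_nonneg)
  have "g x x = (\<Sum>i\<in>F. conjg (c i) * g x (f i))"
    by (subst (2) x(2)) (simp add: g_sum_right g_smul_right)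
  then have "q x \<le> norm (\<Sum>i\<in>F. conjg (c i) * g x (f i))"
    using norm_g_self[of x] by simp
  also have "\<dots> \<le> (\<Sum>i\<in>F. norm (c i) * norm (g x (f i)))"
    by (rule order_trans[OF norm_sum]) (simp add: norm_mult)
  finally have "(q x)\<^sup>2 \<le> (\<Sum>i\<in>F. norm (c i) * norm (g x (f i)))\<^sup>2"
    using posdef_nonneg[OF M x(1)] by (rule power_mono)
  also have "\<dots> \<le> C * s"
    unfolding C_def s_def by (rule Cauchy_Schwarz_ineq_sum)
  finally have "L * (q x)\<^sup>2 \<le> L * (C * s)"
    using \<open>0 \<le> L\<close> by (rule mult_left_mono)
  also have "\<dots> \<le> q x * s"
    using L s by (simp add: C_def mult.assoc[symmetric] mult_right_mono)
  finally have "(L * q x) * q x \<le> s * q x" by (simp add: power2_eq_square mult_ac)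
  then show ?thesis
    using posdef_nonneg[OF M x(1)] s by (cases "q x = 0") (auto simp: s_def[symmetric])
qed

text \<open>The summands are nonnegative, so the finite estimate, being uniform in \<open>F\<close>,
  gives convergence as well as the bound.\<close>

lemma
  assumes M: "posdef_on M" and x: "x \<in> M" and f: "f ` Q \<subseteq> M" and "0 \<le> U"
    and U: "\<And>F c. finite F \<Longrightarrow> F \<subseteq> Q \<Longrightarrow>
      q (\<Sum>i\<in>F. smul (c i) (f i)) \<le> U * (\<Sum>i\<in>F. (norm (c i))\<^sup>2)"
  shows analysis_summable: "(\<lambda>i. (norm (g x (f i)))\<^sup>2) summable_on Q"
    and analysis_upper: "(\<Sum>\<^sub>\<infinity>i\<in>Q. (norm (g x (f i)))\<^sup>2) \<le> U * q x"
proof -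
  have fin: "(\<Sum>i\<in>F. (norm (g x (f i)))\<^sup>2) \<le> U * q x" if "finite F" "F \<subseteq> Q" for F
    using analysis_upper_finite[OF M x _ \<open>0 \<le> U\<close> U] f that by blast
  show s: "(\<lambda>i. (norm (g x (f i)))\<^sup>2) summable_on Q"
    by (rule nonneg_bdd_above_summable_on) (use fin in \<open>auto intro!: bdd_aboveI2\<close>)
  show "(\<Sum>\<^sub>\<infinity>i\<in>Q. (norm (g x (f i)))\<^sup>2) \<le> U * q x"
    by (rule infsum_le_finite_sums[OF s]) (use fin in auto)
qed

text \<open>The finite estimate applies to vectors of the span only. Both sides become seminorms
  after taking square roots, so replacing \<open>x\<close> by a nearby \<open>y\<close> in the span
  costs at most \<open>sqrt U + sqrt L\<close> times their distance.\<close>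

lemma analysis_lower:
  assumes M: "posdef_on M" and x: "x \<in> M" and f: "f ` Q \<subseteq> M" and "0 \<le> L" "0 \<le> U"
    and U: "\<And>F c. finite F \<Longrightarrow> F \<subseteq> Q \<Longrightarrow>
      q (\<Sum>i\<in>F. smul (c i) (f i)) \<le> U * (\<Sum>i\<in>F. (norm (c i))\<^sup>2)"
    and L: "\<And>F c. finite F \<Longrightarrow> F \<subseteq> Q \<Longrightarrow>
      L * (\<Sum>i\<in>F. (norm (c i))\<^sup>2) \<le> q (\<Sum>i\<in>F. smul (c i) (f i))"
    and approx: "\<And>e. e > 0 \<Longrightarrow> \<exists>y\<in>span (f ` Q). q (x - y) < e"
  shows "L * q x \<le> (\<Sum>\<^sub>\<infinity>i\<in>Q. (norm (g x (f i)))\<^sup>2)"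
proof -
  define H where "H = (\<Sum>\<^sub>\<infinity>i\<in>Q. (norm (g x (f i)))\<^sup>2)"
  \<comment> \<open>The Lipschitz constant of the approximation, increased by 1 so that it may be
    divided by even if \<open>U\<close> and \<open>L\<close> vanish.\<close>
  define K where "K = sqrt U + sqrt L + 1"
  have K: "K > 0" unfolding K_def using \<open>0 \<le> L\<close> \<open>0 \<le> U\<close>
    by (intro add_nonneg_pos) auto
  have H: "0 \<le> H" by (simp add: H_def infsum_nonneg)
  have "sqrt L * sqrt (q x) \<le> sqrt H + e" if "e > 0" for e
  proof -
    obtain y where y: "y \<in> span (f ` Q)" and "q (x - y) < (e / K)\<^sup>2"
      using approx[of "(e / K)\<^sup>2"] \<open>e > 0\<close> K by auto
    then have d: "sqrt (q (x - y)) \<le> e / K"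
      using \<open>e > 0\<close> K by (intro real_le_lsqrt) auto
    have yM: "y \<in> M"
      using y f posdef_subspace[OF M] by (meson span_minimal subsetD)
    have xyM: "x - y \<in> M" "y - x \<in> M"
      using x yM posdef_subspace[OF M] by (auto intro: subspace_diff)
    obtain F c where F: "finite F" "F \<subseteq> Q" "y = (\<Sum>i\<in>F. smul (c i) (f i))"
      using y by (rule span_image_sum)
    define n where "n z = L2_set (\<lambda>i. norm (g z (f i))) F" for z
    have n: "n z = sqrt (\<Sum>i\<in>F. (norm (g z (f i)))\<^sup>2)" for z
      by (simp add: n_def L2_set_def)
    have "sqrt L * sqrt (q x) \<le> sqrt L * (sqrt (q y) + sqrt (q (x - y)))"
      using sqrt_q_triangle_diff[OF M x yM] \<open>0 \<le> L\<close> by (simp add: mult_left_mono)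
    also have "sqrt L * sqrt (q y) \<le> n y"
      using analysis_lower_finite[OF M yM F(3) \<open>0 \<le> L\<close>] L[OF F(1,2)] F(3)
      by (simp add: n real_sqrt_mult[symmetric])
    then have "sqrt L * (sqrt (q y) + sqrt (q (x - y))) \<le> n y + sqrt L * sqrt (q (x - y))"
      by (simp add: distrib_left)
    also have "n y \<le> n x + n (y - x)"
    proof -
      have "n y \<le> L2_set (\<lambda>i. norm (g x (f i)) + norm (g (y - x) (f i))) F"
        unfolding n_def
      proof (rule L2_set_mono)
        fix i
        show "norm (g y (f i)) \<le> norm (g x (f i)) + norm (g (y - x) (f i))"
          using norm_triangle_ineq[of "g x (f i)" "g (y - x) (f i)"] by (simp add: g_diff_left)
      qed auto
      also have "\<dots> \<le> n x + n (y - x)" unfolding n_def by (rule L2_set_triangle_ineq)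
      finally show ?thesis .
    qed
    also have "n x \<le> sqrt H"
      unfolding n H_def
      by (intro real_sqrt_le_mono finite_sum_le_infsum F analysis_summable[OF M x f \<open>0 \<le> U\<close> U]) auto
    also have "n (y - x) \<le> sqrt U * sqrt (q (x - y))"
      unfolding n real_sqrt_mult[symmetric] q_diff_commute[of x y]
      by (intro real_sqrt_le_mono analysis_upper_finite[OF M xyM(2) _ \<open>0 \<le> U\<close> U]) (use F f in auto)
    finally have "sqrt L * sqrt (q x) \<le> sqrt H + (sqrt U + sqrt L) * sqrt (q (x - y))"
      by (simp add: algebra_simps)
    also have "(sqrt U + sqrt L) * sqrt (q (x - y)) \<le> K * (e / K)"
      using d K posdef_nonneg[OF M xyM(1)] \<open>0 \<le> L\<close> \<open>0 \<le> U\<close>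
      by (intro mult_mono) (auto simp: K_def)
    finally show ?thesis using K by simp
  qed
  then have "sqrt L * sqrt (q x) \<le> sqrt H" by (rule field_le_epsilon)
  then show ?thesis by (simp add: H_def real_sqrt_mult[symmetric])
qed

text \<open>The Gram matrix differs from \<alpha> times the identity by a matrix \<open>E\<close>
  dominated entrywise by the rank-one matrix with entries \<open>\<epsilon> * w i * w j\<close>. The
  quadratic form of the latter is controlled by the sum of the squares of \<open>w\<close>,
  independently of the size of \<open>F\<close>.\<close>

lemma gram_estimate:
  assumes F: "finite F"
    and gram: "\<And>i j. i \<in> F \<Longrightarrow> j \<in> F \<Longrightarrow>
      norm (g (f i) (f j) - (if i = j then of_real \<alpha> else 0)) \<le> \<epsilon> * w i * w j"
    and w: "\<And>i. i \<in> F \<Longrightarrow> 0 \<le> w i" "(\<Sum>i\<in>F. (w i)\<^sup>2) \<le> W" and "0 \<le> \<epsilon>"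
  shows "\<bar>q (\<Sum>i\<in>F. smul (c i) (f i)) - \<alpha> * (\<Sum>i\<in>F. (norm (c i))\<^sup>2)\<bar>
    \<le> \<epsilon> * W * (\<Sum>i\<in>F. (norm (c i))\<^sup>2)"
proof -
  define E where "E i j = g (f i) (f j) - (if i = j then of_real \<alpha> else 0)" for i j
  define C where "C = (\<Sum>i\<in>F. (norm (c i))\<^sup>2)"
  have "(\<Sum>i\<in>F. \<Sum>j\<in>F. re (c i * conjg (c j) * (if i = j then of_real \<alpha> else 0))) = \<alpha> * C"
  proof -
    have "re (c i * conjg (c i) * of_real \<alpha>) = \<alpha> * (norm (c i))\<^sup>2" for i
      by (simp add: mult_conjg_of_real mult.commute flip: of_real_mult del: of_real_power)
    then show ?thesis
      using F by (simp add: C_def sum_distrib_left if_distrib[of "\<lambda>z. _ * z"]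
          if_distrib[of re] cong: if_cong)
  qed
  then have "q (\<Sum>i\<in>F. smul (c i) (f i)) - \<alpha> * C
      = (\<Sum>i\<in>F. \<Sum>j\<in>F. re (c i * conjg (c j) * E i j))"
    by (simp add: q_sum E_def right_diff_distrib re_diff sum_subtractf)
  also have "\<bar>\<dots>\<bar> \<le> (\<Sum>i\<in>F. \<Sum>j\<in>F. \<bar>re (c i * conjg (c j) * E i j)\<bar>)"
    by (rule order_trans[OF sum_abs sum_mono[OF sum_abs]])
  also have "\<dots> \<le> (\<Sum>i\<in>F. \<Sum>j\<in>F. norm (c i) * norm (c j) * (\<epsilon> * w i * w j))"
  proof (intro sum_mono)
    fix i j assume ij: "i \<in> F" "j \<in> F"
    have "\<bar>re (c i * conjg (c j) * E i j)\<bar> \<le> norm (c i) * norm (c j) * norm (E i j)"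
      using abs_re_le_norm[of "c i * conjg (c j) * E i j"] by (simp add: norm_mult)
    also have "\<dots> \<le> norm (c i) * norm (c j) * (\<epsilon> * w i * w j)"
      using gram[OF ij] by (simp add: E_def mult_left_mono)
    finally show "\<bar>re (c i * conjg (c j) * E i j)\<bar> \<le> norm (c i) * norm (c j) * (\<epsilon> * w i * w j)" .
  qed
  also have "\<dots> = \<epsilon> * (\<Sum>i\<in>F. norm (c i) * w i)\<^sup>2"
    by (simp add: power2_eq_square sum_product sum_distrib_left mult_ac)
  also have "\<dots> \<le> \<epsilon> * (C * (\<Sum>i\<in>F. (w i)\<^sup>2))"
    unfolding C_def by (intro mult_left_mono Cauchy_Schwarz_ineq_sum \<open>0 \<le> \<epsilon>\<close>)
  also have "\<dots> \<le> \<epsilon> * (C * W)"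
    using w(2) \<open>0 \<le> \<epsilon>\<close> by (intro mult_left_mono) (auto simp: C_def sum_nonneg)
  finally show ?thesis by (simp add: C_def mult_ac)
qed

end

section \<open>Families all of whose subfamilies have the same optimal bounds\<close>

lemma infsum_remainder_less:
  fixes h :: "'a \<Rightarrow> real"
  assumes "h summable_on A" "e > 0"
  obtains F where "finite F" "F \<subseteq> A" "(\<Sum>\<^sub>\<infinity>i\<in>A - F. h i) < e" "h summable_on (A - F)"
proof -
  obtain F where F: "finite F" "F \<subseteq> A" "dist (sum h F) (infsum h A) \<le> e / 2"
    using infsum_finite_approximation[OF assms(1), of "e / 2"] assms(2) by auto
  have s: "h summable_on (A - F)"
    using assms(1) by (rule summable_on_subset_banach) auto
  have "infsum h A = infsum h F + infsum h (A - F)"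
    using infsum_Un_disjoint[of h F "A - F"] F s by (simp add: Un_absorb1)
  then show thesis
    using that[OF F(1,2) _ s] F assms(2) by (simp add: dist_real_def)
qed

text \<open>\<open>Cl\<close> stands for the closed span in a topology finer than that of \<open>g\<close> on \<open>M\<close>; only the
  subfamilies with index set \<open>P \<inter> S\<close> for infinite \<open>S\<close> arise from subsequences.\<close>

locale optimal_family = hermitian_space smul g
  for smul :: "'k::real_or_complex \<Rightarrow> 'v::ab_group_add \<Rightarrow> 'v" and g +
  fixes M :: "'v set" and P :: "nat set" and f :: "nat \<Rightarrow> 'v"
    and Cl :: "'v set \<Rightarrow> 'v set" and a b :: real
  assumes M: "posdef_on M"
    and f_M: "\<And>i. i \<in> P \<Longrightarrow> f i \<in> M" and f_nz: "\<And>i. i \<in> P \<Longrightarrow> f i \<noteq> 0"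
    and Cl_superset: "\<And>T. T \<subseteq> f ` P \<Longrightarrow> T \<subseteq> Cl T"
    and Cl_M: "\<And>T. T \<subseteq> f ` P \<Longrightarrow> Cl T \<subseteq> M"
    and Cl_approx: "\<And>T x e. T \<subseteq> f ` P \<Longrightarrow> x \<in> Cl T \<Longrightarrow> e > 0 \<Longrightarrow> \<exists>y\<in>span T. q (x - y) < e"
    and a_pos: "0 < a" and a_le_b: "a \<le> b"
    and lower: "\<And>S x. infinite S \<Longrightarrow> x \<in> Cl (f ` (P \<inter> S)) \<Longrightarrow>
      a * q x \<le> (\<Sum>\<^sub>\<infinity>i\<in>P \<inter> S. (norm (g x (f i)))\<^sup>2)"
    and upper: "\<And>S x. infinite S \<Longrightarrow> x \<in> Cl (f ` (P \<inter> S)) \<Longrightarrow>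
      (\<Sum>\<^sub>\<infinity>i\<in>P \<inter> S. (norm (g x (f i)))\<^sup>2) \<le> b * q x"
    and lower_optimal: "\<And>S a'. infinite S \<Longrightarrow> P \<inter> S \<noteq> {} \<Longrightarrow> a' > 0 \<Longrightarrow>
      (\<And>x. x \<in> Cl (f ` (P \<inter> S)) \<Longrightarrow> a' * q x \<le> (\<Sum>\<^sub>\<infinity>i\<in>P \<inter> S. (norm (g x (f i)))\<^sup>2)) \<Longrightarrow> a' \<le> a"
    and upper_optimal: "\<And>S b'. infinite S \<Longrightarrow> P \<inter> S \<noteq> {} \<Longrightarrow> b' > 0 \<Longrightarrow>
      (\<And>x. x \<in> Cl (f ` (P \<inter> S)) \<Longrightarrow> (\<Sum>\<^sub>\<infinity>i\<in>P \<inter> S. (norm (g x (f i)))\<^sup>2) \<le> b' * q x) \<Longrightarrow> b \<le> b'"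
begin

lemma q_pos: "i \<in> P \<Longrightarrow> 0 < q (f i)"
  using M f_M f_nz by (auto simp: posdef_on_def)

lemma f_in_Cl: "i \<in> P \<Longrightarrow> i \<in> S \<Longrightarrow> f i \<in> Cl (f ` (P \<inter> S))"
  using Cl_superset[of "f ` (P \<inter> S)"] by blast

text \<open>The hypothesis compares squares of finite combinations with \<alpha> times the squares
  of their coefficients. The analysis estimates turn this into frame inequalities with constants
  \<open>\<alpha> - \<delta>\<close> and \<open>\<alpha> + \<delta>\<close>, which optimality
  compares with \<open>a\<close> and \<open>b\<close>.\<close>

lemma bounds_near:
  assumes S: "infinite S" "P \<inter> S \<noteq> {}" and "0 < \<alpha>" "0 \<le> \<delta>"
    and near: "\<And>F c. finite F \<Longrightarrow> F \<subseteq> P \<inter> S \<Longrightarrow>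
      \<bar>q (\<Sum>i\<in>F. smul (c i) (f i)) - \<alpha> * (\<Sum>i\<in>F. (norm (c i))\<^sup>2)\<bar>
        \<le> \<delta> * (\<Sum>i\<in>F. (norm (c i))\<^sup>2)"
  shows "\<alpha> - \<delta> \<le> a" "b \<le> \<alpha> + \<delta>"
proof -
  have T: "f ` (P \<inter> S) \<subseteq> f ` P" "f ` (P \<inter> S) \<subseteq> M" using f_M by auto
  have U: "q (\<Sum>i\<in>F. smul (c i) (f i)) \<le> (\<alpha> + \<delta>) * (\<Sum>i\<in>F. (norm (c i))\<^sup>2)"
    and L: "(\<alpha> - \<delta>) * (\<Sum>i\<in>F. (norm (c i))\<^sup>2) \<le> q (\<Sum>i\<in>F. smul (c i) (f i))"
    if "finite F" "F \<subseteq> P \<inter> S" for F c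
    using near[OF that, of c] by (auto simp: algebra_simps abs_le_iff)
  have U0: "0 \<le> \<alpha> + \<delta>" using \<open>0 < \<alpha>\<close> \<open>0 \<le> \<delta>\<close> by simp
  have xM: "x \<in> M" if "x \<in> Cl (f ` (P \<inter> S))" for x
    using Cl_M[OF T(1)] that by blast
  show "b \<le> \<alpha> + \<delta>"
    by (rule upper_optimal[OF S]) (use \<open>0 < \<alpha>\<close> \<open>0 \<le> \<delta>\<close> analysis_upper[OF M xM T(2) U0 U] in auto)
  show "\<alpha> - \<delta> \<le> a"
  \<comment> \<open>Optimality speaks of positive constants only; a nonpositive one lies below
    \<open>a\<close> trivially.\<close>
  proof (cases "\<alpha> - \<delta> > 0")
    case True
    show ?thesis
      by (rule lower_optimal[OF S True])
        (rule analysis_lower[OF M xM T(2) _ U0 U L Cl_approx[OF T(1)]], use True in auto)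
  qed (use a_pos in simp)
qed

lemma bounds_eq_if_finite:
  assumes "finite P" "m \<in> P"
  shows "a = q (f m)" "b = q (f m)"
proof -
  \<comment> \<open>Infinite because \<open>P\<close> is finite, yet it meets \<open>P\<close> in
    \<open>m\<close> alone. For a single vector the comparison in \<open>bounds_near\<close> is
    exact, with error 0.\<close>
  define S where "S = insert m (- P)"
  have S: "infinite S" "P \<inter> S = {m}"
    using assms by (auto simp: S_def)
  have near: "\<bar>q (\<Sum>i\<in>F. smul (c i) (f i)) - q (f m) * (\<Sum>i\<in>F. (norm (c i))\<^sup>2)\<bar>
      \<le> 0 * (\<Sum>i\<in>F. (norm (c i))\<^sup>2)" if "finite F" "F \<subseteq> P \<inter> S" for F c
  proof -
    have "F = {} \<or> F = {m}" using that S by (simp add: subset_singleton_iff)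
    then show ?thesis by (auto simp: q_smul)
  qed
  have ne: "P \<inter> S \<noteq> {}" using S by simp
  show "a = q (f m)" "b = q (f m)"
    using bounds_near[OF S(1) ne q_pos[OF assms(2)] order.refl near] a_le_b by auto
qed

section \<open>Estimates for single members of the family\<close>

lemma summable_P:
  assumes "m \<in> P"
  shows "(\<lambda>i. (norm (g (f m) (f i)))\<^sup>2) summable_on P"
proof (rule ccontr)
  assume "\<not> ?thesis"
  \<comment> \<open>The infinite sum of a non-summable family has the default value 0, which the
    lower frame inequality at \<open>f m\<close> then bounds from below.\<close>
  then have "a * q (f m) \<le> 0"
    using lower[of UNIV "f m"] f_in_Cl[of m UNIV] assms by (simp add: infsum_not_exists)
  then show False
    using mult_pos_pos[OF a_pos q_pos[OF assms]] by simp
qed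

text \<open>In the upper frame inequality at \<open>f m\<close> the term of index \<open>m\<close>
  alone is already the square of \<open>q (f m)\<close>.\<close>

lemma q_le_b:
  assumes "m \<in> P"
  shows "q (f m) \<le> b"
proof -
  have "(q (f m))\<^sup>2 = (\<Sum>i\<in>{m}. (norm (g (f m) (f i)))\<^sup>2)" by (simp add: norm_g_self)
  also have "\<dots> \<le> (\<Sum>\<^sub>\<infinity>i\<in>P. (norm (g (f m) (f i)))\<^sup>2)"
    by (rule finite_sum_le_infsum) (use assms summable_P[OF assms] in auto)
  also have "\<dots> \<le> b * q (f m)"
    using upper[of UNIV "f m"] f_in_Cl[of m UNIV] assms by simp
  finally show ?thesis using q_pos[OF assms] by (simp add: power2_eq_square)
qed

text \<open>Keep \<open>f m\<close> and delete a finite set carrying almost all of the analysis coefficients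
  of \<open>f m\<close>: the lower bound for what remains is the claim.\<close>

lemma a_le_q:
  assumes m: "m \<in> P"
  shows "a \<le> q (f m)"
proof -
  have "a * q (f m) \<le> (q (f m))\<^sup>2 + e" if "e > 0" for e
  proof -
    let ?h = "\<lambda>i. (norm (g (f m) (f i)))\<^sup>2"
    obtain F where F: "finite F" "F \<subseteq> P" "infsum ?h (P - F) < e" "?h summable_on (P - F)"
      using infsum_remainder_less[OF summable_P[OF m] \<open>e > 0\<close>] by blast
    define S where "S = insert m (- F)"
    have "infinite S" using F(1) by (simp add: S_def)
    then have "a * q (f m) \<le> infsum ?h (P \<inter> S)"
      using m by (intro lower f_in_Cl) (auto simp: S_def)
    also have "P \<inter> S = {m} \<union> (P - F - {m})" using m by (auto simp: S_def)
    also have "infsum ?h \<dots> = ?h m + infsum ?h (P - F - {m})"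
      by (subst infsum_Un_disjoint) (auto intro: summable_on_subset_banach[OF F(4)])
    also have "infsum ?h (P - F - {m}) \<le> infsum ?h (P - F)"
      by (rule infsum_mono2) (auto intro: summable_on_subset_banach[OF F(4)] F(4))
    also have "?h m = (q (f m))\<^sup>2" by (simp add: norm_g_self)
    finally show ?thesis using F(3) by simp
  qed
  then have "a * q (f m) \<le> (q (f m))\<^sup>2" by (rule field_le_epsilon)
  then show ?thesis using q_pos[OF m] by (simp add: power2_eq_square)
qed

section \<open>Weak decay of the coefficients and an almost orthogonal subsequence\<close>

lemma finite_large_coefficients:
  assumes "m \<in> P" "e > 0"
  shows "finite {n \<in> P. e < norm (g (f m) (f n))}"
proof -
  let ?h = "\<lambda>i. (norm (g (f m) (f i)))\<^sup>2"
  obtain F where F: "finite F" "F \<subseteq> P" "infsum ?h (P - F) < e\<^sup>2" "?h summable_on (P - F)"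
    using infsum_remainder_less[OF summable_P[OF assms(1)], of "e\<^sup>2"] assms(2) by auto
  have "norm (g (f m) (f n)) \<le> e" if "n \<in> P - F" for n
  proof -
    have "?h n \<le> infsum ?h (P - F)"
      using finite_sum_le_infsum[OF F(4), of "{n}"] that by simp
    then have "?h n \<le> e\<^sup>2" using F(3) by simp
    then show ?thesis by (rule power2_le_imp_le) (use assms(2) in simp)
  qed
  then have "{n \<in> P. e < norm (g (f m) (f n))} \<subseteq> F" by force
  then show ?thesis using F(1) finite_subset by blast
qed

text \<open>All values \<open>q (f n)\<close> lie in the compact interval from \<open>a\<close> to
  \<open>b\<close>. The limit point is recorded through infinite index sets because these survive
  the deletion of finitely many indices.\<close>

lemma q_accumulation:
  assumes "infinite P"
  obtains \<alpha> where "a \<le> \<alpha>" "\<And>e. e > 0 \<Longrightarrow> infinite {n \<in> P. \<bar>q (f n) - \<alpha>\<bar> < e}"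
proof -
  let ?p = "enumerate P"
  have p: "?p n \<in> P" for n using assms by (rule enumerate_in_set)
  have "\<forall>n. (q \<circ> f \<circ> ?p) n \<in> {a..b}"
    using a_le_q[OF p] q_le_b[OF p] by simp
  then obtain \<alpha> r where \<alpha>: "\<alpha> \<in> {a..b}" "strict_mono r" "(q \<circ> f \<circ> ?p \<circ> r) \<longlonglongrightarrow> \<alpha>"
    using seq_compactE[OF compact_imp_seq_compact[OF compact_Icc[of a b]]] by metis
  have "infinite {n \<in> P. \<bar>q (f n) - \<alpha>\<bar> < e}" if "e > 0" for e
  proof -
    obtain N where N: "\<And>n. n \<ge> N \<Longrightarrow> \<bar>q (f (?p (r n))) - \<alpha>\<bar> < e"
      using LIMSEQ_D[OF \<alpha>(3) \<open>e > 0\<close>] by auto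
    have "(?p \<circ> r) ` {N..} \<subseteq> {n \<in> P. \<bar>q (f n) - \<alpha>\<bar> < e}"
      using N p by auto
    moreover have "inj (?p \<circ> r)"
      by (intro strict_mono_imp_inj_on strict_mono_o strict_mono_enumerate assms \<alpha>)
    then have "infinite ((?p \<circ> r) ` {N..})"
      using finite_imageD[OF _ inj_on_subset[OF \<open>inj (?p \<circ> r)\<close>]] infinite_Ici by blast
    ultimately show ?thesis using finite_subset by blast
  qed
  with \<alpha>(1) show thesis using that by auto
qed

text \<open>Indices are chosen recursively: only finitely many members correlate noticeably with the
  earlier ones, so the next index can avoid them while its square stays close to \<alpha>.\<close>

lemma sparse_subsequence:
  assumes \<alpha>: "\<And>e. e > 0 \<Longrightarrow> infinite {n \<in> P. \<bar>q (f n) - \<alpha>\<bar> < e}" and "\<epsilon> > 0"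
  obtains s :: "nat \<Rightarrow> nat" where "strict_mono s" "range s \<subseteq> P"
    "\<And>i k. norm (g (f (s i)) (f (s k)) - (if i = k then of_real \<alpha> else 0)) \<le> \<epsilon> / 2 ^ i / 2 ^ k"
proof -
  \<comment> \<open>The bound is imposed against every earlier member of \<open>P\<close>, since the
    recursive choice sees only the last index chosen. The identity
    \<open>4 ^ k = 2 ^ k * 2 ^ k\<close> provides one power of 2 for each index of a Gram
    entry.\<close>
  let ?Q = "\<lambda>k x y. x < y \<and> (\<forall>i\<in>P. i \<le> x \<longrightarrow> norm (g (f i) (f y)) \<le> \<epsilon> / 4 ^ Suc k)"
  have "\<exists>s. \<forall>k. (s k \<in> P \<and> \<bar>q (f (s k)) - \<alpha>\<bar> < \<epsilon> / 4 ^ k) \<and> ?Q k (s k) (s (Suc k))"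
  proof (rule dependent_nat_choice)
    show "\<exists>x. x \<in> P \<and> \<bar>q (f x) - \<alpha>\<bar> < \<epsilon> / 4 ^ 0"
      using infinite_imp_nonempty[OF \<alpha>[OF \<open>\<epsilon> > 0\<close>]] by auto
  next
    fix x k
    define e where "e = \<epsilon> / 4 ^ Suc k"
    have "e > 0" using \<open>\<epsilon> > 0\<close> by (simp add: e_def)
    let ?B = "{..x} \<union> (\<Union>i\<in>{i\<in>P. i \<le> x}. {n \<in> P. e < norm (g (f i) (f n))})"
    have "finite ?B" using finite_large_coefficients \<open>e > 0\<close> by auto
    then have "infinite ({n \<in> P. \<bar>q (f n) - \<alpha>\<bar> < e} - ?B)"
      using \<alpha>[OF \<open>e > 0\<close>] by simp
    then obtain y where "y \<in> {n \<in> P. \<bar>q (f n) - \<alpha>\<bar> < e} - ?B"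
      using infinite_imp_nonempty by blast
    then show "\<exists>y. (y \<in> P \<and> \<bar>q (f y) - \<alpha>\<bar> < \<epsilon> / 4 ^ Suc k) \<and> ?Q k x y"
      by (intro exI[of _ y]) (auto simp: e_def not_less)
  qed
  then obtain s where s: "\<And>k. s k \<in> P" "\<And>k. \<bar>q (f (s k)) - \<alpha>\<bar> < \<epsilon> / 4 ^ k"
    "\<And>k. ?Q k (s k) (s (Suc k))" by blast
  have mono: "strict_mono s" using s(3) by (simp add: strict_mono_Suc_iff)
  have off: "norm (g (f (s i)) (f (s k))) \<le> \<epsilon> / 2 ^ i / 2 ^ k" if "i < k" for i k
  proof -
    obtain l where l: "k = Suc l" "i \<le> l" using \<open>i < k\<close> by (cases k) auto
    then have "norm (g (f (s i)) (f (s k))) \<le> \<epsilon> / 4 ^ k"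
      using s(3)[of l] s(1)[of i] strict_mono_less_eq[OF mono] by auto
    also have "\<dots> = \<epsilon> / 2 ^ k / 2 ^ k" by (simp add: power_mult_distrib[symmetric])
    also have "\<dots> \<le> \<epsilon> / 2 ^ i / 2 ^ k"
      using \<open>\<epsilon> > 0\<close> \<open>i < k\<close> by (intro divide_right_mono divide_left_mono) auto
    finally show ?thesis .
  qed
  have "norm (g (f (s i)) (f (s k)) - (if i = k then of_real \<alpha> else 0)) \<le> \<epsilon> / 2 ^ i / 2 ^ k" for i k
  proof (cases i k rule: linorder_cases)
    case equal
    have "norm (g (f (s i)) (f (s i)) - of_real \<alpha>) = \<bar>q (f (s i)) - \<alpha>\<bar>"
      by (simp add: g_self flip: of_real_diff)
    also have "\<dots> \<le> \<epsilon> / 4 ^ i" using s(2)[of i] by simp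
    also have "\<dots> = \<epsilon> / 2 ^ i / 2 ^ i" by (simp add: power_mult_distrib[symmetric])
    finally show ?thesis using equal by simp
  next
    case less
    then show ?thesis using off by simp
  next
    case greater
    then show ?thesis using off[of k i] by (simp add: norm_g_sym[of "f (s i)"] mult.commute)
  qed
  then show thesis using that mono s(1) by blast
qed

lemma bounds_eq:
  assumes "P \<noteq> {}"
  shows "a = b"
proof (cases "finite P")
  case True
  with assms show ?thesis using bounds_eq_if_finite by blast
next
  case False
  obtain \<alpha> where \<alpha>: "a \<le> \<alpha>" "\<And>e. e > 0 \<Longrightarrow> infinite {n \<in> P. \<bar>q (f n) - \<alpha>\<bar> < e}"
    using q_accumulation[OF False] by blast
  have "b \<le> a + e" if "e > 0" for e
  proof -
    \<comment> \<open>The subsequence will have error \<open>\<epsilon> * 2\<close> on either side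
      of \<alpha>, hence \<open>b - a\<close> is at most \<open>4 * \<epsilon>\<close>.\<close>
    define \<epsilon> where "\<epsilon> = e / 4"
    have \<epsilon>: "\<epsilon> > 0" using that by (simp add: \<epsilon>_def)
    obtain s where s: "strict_mono s" "range s \<subseteq> P"
      "\<And>i k. norm (g (f (s i)) (f (s k)) - (if i = k then of_real \<alpha> else 0)) \<le> \<epsilon> / 2 ^ i / 2 ^ k"
      using sparse_subsequence[OF \<alpha>(2) \<epsilon>] by metis
    have inj: "inj s" using s(1) by (rule strict_mono_imp_inj_on)
    \<comment> \<open>The weights \<open>1 / 2 ^ k\<close> carried over to the indices
      \<open>s k\<close>; the sum of their squares is at most that of a geometric series,
      4/3.\<close>
    define w :: "nat \<Rightarrow> real" where "w i = 1 / 2 ^ inv s i" for i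
    have [simp]: "w (s k) = 1 / 2 ^ k" for k by (simp add: w_def inv_f_f[OF inj])
    have S: "P \<inter> range s = range s" "infinite (range s)"
      using s(2) inj by (auto simp: range_inj_infinite)
    have "\<bar>q (\<Sum>i\<in>F. smul (c i) (f i)) - \<alpha> * (\<Sum>i\<in>F. (norm (c i))\<^sup>2)\<bar>
        \<le> (\<epsilon> * 2) * (\<Sum>i\<in>F. (norm (c i))\<^sup>2)" if F: "finite F" "F \<subseteq> P \<inter> range s" for F c
    proof (rule gram_estimate[where w = w])
      fix i j assume "i \<in> F" "j \<in> F"
      then obtain k l where kl: "i = s k" "j = s l" using F(2) by blast
      show "norm (g (f i) (f j) - (if i = j then of_real \<alpha> else 0)) \<le> \<epsilon> * w i * w j"
        using s(3)[of k l] by (simp add: kl inj_eq[OF inj])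
    next
      obtain G where G: "finite G" "F = s ` G"
        using F S(1) finite_subset_image by metis
      have "(\<Sum>i\<in>F. (w i)\<^sup>2) = (\<Sum>k\<in>G. (1 / 4) ^ k)"
        unfolding G(2)
        by (subst sum.reindex) (auto intro: inj_on_subset[OF inj] sum.cong
            simp: power_divide power_mult_distrib[symmetric] power2_eq_square)
      also have "\<dots> \<le> (\<Sum>k. (1 / 4 :: real) ^ k)"
        by (rule sum_le_suminf) (use G in \<open>auto intro: summable_geometric\<close>)
      also have "\<dots> \<le> 2" by (subst suminf_geometric) auto
      finally show "(\<Sum>i\<in>F. (w i)\<^sup>2) \<le> 2" .
    qed (use F \<epsilon> in \<open>auto simp: w_def\<close>)
    then have "\<alpha> - \<epsilon> * 2 \<le> a" "b \<le> \<alpha> + \<epsilon> * 2"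
      using bounds_near[of "range s" \<alpha> "\<epsilon> * 2"] S \<epsilon> \<alpha>(1) a_pos by auto
    then show ?thesis by (simp add: \<epsilon>_def)
  qed
  then have "b \<le> a" by (rule field_le_epsilon)
  with a_le_b show ?thesis by simp
qed

text \<open>With \<open>a = b\<close> the \<open>m\<close>-th coefficient alone exhausts the frame inequality at \<open>f m\<close>.\<close>

lemma orthogonal:
  assumes m: "m \<in> P" and n: "n \<in> P" "n \<noteq> m"
  shows "g (f m) (f n) = 0"
proof -
  have "q (f m) = b"
  proof -
    have "a = b" using bounds_eq m by blast
    then show ?thesis using q_le_b[OF m] a_le_q[OF m] by simp
  qed
  have "(\<Sum>i\<in>{m, n}. (norm (g (f m) (f i)))\<^sup>2) \<le> (\<Sum>\<^sub>\<infinity>i\<in>P. (norm (g (f m) (f i)))\<^sup>2)"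
    by (rule finite_sum_le_infsum) (use m n summable_P[OF m] in auto)
  also have "\<dots> \<le> b * q (f m)"
    using upper[of UNIV "f m"] f_in_Cl[of m UNIV] m by simp
  finally have "(q (f m))\<^sup>2 + (norm (g (f m) (f n)))\<^sup>2 \<le> b * q (f m)"
    using n by (simp add: norm_g_self)
  then show ?thesis using \<open>q (f m) = b\<close> by (simp add: power2_eq_square[of b])
qed

text \<open>Orthogonality extends to the span of the other members, so by Pythagoras no vector
  \<open>y\<close> there satisfies \<open>q (f m - y) < q (f m)\<close>.\<close>

lemma not_in_closed_span_others:
  assumes "m \<in> P"
  shows "f m \<notin> Cl (f ` (P - {m}))"
proof
  assume "f m \<in> Cl (f ` (P - {m}))"
  then obtain y where y: "y \<in> span (f ` (P - {m}))" "q (f m - y) < q (f m)"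
    using Cl_approx[of "f ` (P - {m})" "f m" "q (f m)"] q_pos[OF assms] by auto
  have "g (f m) y = 0"
    using y(1)
    by (induction rule: span_induct_alt)
      (use assms orthogonal in \<open>auto simp: g_add_right g_smul_right\<close>)
  then have "q (f m - y) = q (f m) + q y"
    using q_add[of "f m" "- y"] by (simp add: g_minus_right)
  moreover have "span (f ` (P - {m})) \<subseteq> M"
    by (intro span_minimal image_subsetI posdef_subspace[OF M] f_M) auto
  then have "0 \<le> q y" using y(1) posdef_nonneg[OF M] by blast
  ultimately show False using y(2) by simp
qed

end

section \<open>Krein spaces\<close>

lemma hermitian_formI:
  assumes "\<And>x y z. form (x + y) z = form x z + form y z"
    and "\<And>c x y. form (smul c x) y = c * form x y"
    and "\<And>x y. form y x = conjg (form x y)"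
  shows "hermitian_form smul form"
  unfolding hermitian_form_def using assms by blast

context krein_space
begin

sublocale fm: hermitian_space smul form
  by unfold_locales (rule hermitian)

text \<open>Reversing the sign makes uniformly \<open>J\<close>-negative subspaces positive
  definite, so that the results on \<open>optimal_family\<close> serve both sides.\<close>

sublocale neg: hermitian_space smul "\<lambda>x y. - form x y"
proof unfold_locales
  show "hermitian_form smul (\<lambda>x y. - form x y)"
  proof (rule hermitian_formI)
    show "- form y x = conjg (- form x y)" for x y
      by (metis conjg_minus fm.g_conj)
  qed (simp_all add: fm.g_add_left fm.g_smul_left)
qed

lemma neg_q: "neg.q x = - fm.q x"
  by (simp add: neg.q_def fm.q_def re_minus)

section \<open>The canonical decomposition and the \<open>J\<close>-inner product\<close>

lemma subspace_Kp: "subspace Kp" and subspace_Km: "subspace Km"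
  using hilbert_Kp hilbert_Km by (auto simp: hilbert_subspace_def)

lemma Kp_pos: "x \<in> Kp \<Longrightarrow> x \<noteq> 0 \<Longrightarrow> 0 < fm.q x"
  and Km_neg: "x \<in> Km \<Longrightarrow> x \<noteq> 0 \<Longrightarrow> fm.q x < 0"
  using hilbert_Kp hilbert_Km by (auto simp: hilbert_subspace_def fm.q_def re_minus)

lemma Km_Kp_orthogonal: "x \<in> Km \<Longrightarrow> y \<in> Kp \<Longrightarrow> form x y = 0"
  using Kp_Km_orthogonal[of y x] fm.g_conj[of x y] by simp

lemma decomposition_unique:
  assumes "p \<in> Kp" "m \<in> Km" "p' \<in> Kp" "m' \<in> Km" "p + m = p' + m'"
  shows "p' = p" "m' = m"
proof -
  have "p' - p = m - m'" using assms(5) by (simp add: algebra_simps)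
  moreover have "p' - p \<in> Kp" "m - m' \<in> Km"
    using assms subspace_Kp subspace_Km by (auto intro: subspace_diff)
  ultimately have "p' - p \<in> Kp \<inter> Km" by simp
  then show "p' = p" using Kp_Km_inter by simp
  then show "m' = m" using assms(5) by simp
qed

lemma J_decomposition:
  assumes "p \<in> Kp" "m \<in> Km"
  shows "J (p + m) = p - m"
proof -
  have "P_plus (p + m) = p" unfolding P_plus_def
    using assms decomposition_unique(1)[OF assms]
    by (intro the_equality) (auto simp: algebra_simps)
  moreover have "P_minus (p + m) = m" unfolding P_minus_def
    using assms decomposition_unique(2)[OF assms]
    by (intro the_equality) (auto simp: algebra_simps)
  ultimately show ?thesis by (simp add: J_def)
qed

lemma J_inner_decomposition:
  assumes "p \<in> Kp" "m \<in> Km" "p' \<in> Kp" "m' \<in> Km"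
  shows "J_inner (p + m) (p' + m') = form p p' - form m m'"
  using assms by (simp add: J_inner_def J_decomposition fm.g_add_left fm.g_diff_right
      Kp_Km_orthogonal Km_Kp_orthogonal)

sublocale Jn: hermitian_space smul J_inner
proof unfold_locales
  show "hermitian_form smul J_inner"
  proof (rule hermitian_formI)
    fix x y
    obtain p m p' m' where *: "p \<in> Kp" "m \<in> Km" "x = p + m" "p' \<in> Kp" "m' \<in> Km" "y = p' + m'"
      using Kp_Km_sum by metis
    show "J_inner y x = conjg (J_inner x y)"
      using fm.g_conj[of p' p] fm.g_conj[of m' m]
      by (simp add: * J_inner_decomposition conjg_diff)
  qed (simp_all add: J_inner_def fm.g_add_left fm.g_smul_left)
qed

text \<open>For \<open>x = p + m\<close> the two squares are \<open>fm.q p - fm.q m\<close> and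
  \<open>fm.q p + fm.q m\<close>, where \<open>fm.q p\<close> is nonnegative and
  \<open>fm.q m\<close> nonpositive. The inequality transfers approximation in the
  \<open>J\<close>-norm to the form.\<close>

lemma Jn_posdef: "Jn.posdef_on UNIV"
  and abs_q_le_Jn_q: "\<bar>fm.q x\<bar> \<le> Jn.q x"
proof -
  have "\<bar>fm.q x\<bar> \<le> Jn.q x \<and> (x \<noteq> 0 \<longrightarrow> 0 < Jn.q x)" for x
  proof -
    obtain p m where *: "p \<in> Kp" "m \<in> Km" "x = p + m" using Kp_Km_sum by metis
    have "Jn.q x = fm.q p - fm.q m"
      by (simp add: Jn.q_def fm.q_def * J_inner_decomposition re_diff)
    moreover have "fm.q x = fm.q p + fm.q m"
      by (simp add: * fm.q_add Kp_Km_orthogonal)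
    moreover have "0 \<le> fm.q p" "p \<noteq> 0 \<longrightarrow> 0 < fm.q p"
      using Kp_pos[of p] * by (cases "p = 0"; auto)+
    moreover have "fm.q m \<le> 0" "m \<noteq> 0 \<longrightarrow> fm.q m < 0"
      using Km_neg[of m] * by (cases "m = 0"; auto)+
    ultimately show ?thesis using *(3) by (cases "p = 0"; cases "m = 0") auto
  qed
  then show "Jn.posdef_on UNIV" "\<bar>fm.q x\<bar> \<le> Jn.q x"
    by (auto simp: Jn.posdef_on_def)
qed

section \<open>The \<open>J\<close>-norm, its metric and closed spans\<close>

lemma J_norm_eq: "J_norm x = sqrt (Jn.q x)"
  by (simp add: J_norm_def Jn.q_def)

lemma J_norm_smul: "J_norm (smul c x) = norm c * J_norm x"
  by (simp add: J_norm_eq Jn.q_smul real_sqrt_mult)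

lemma Jn_q_nonneg: "0 \<le> Jn.q x"
  using Jn.posdef_nonneg[OF Jn_posdef] by simp

lemma J_norm_pos: "x \<noteq> 0 \<Longrightarrow> 0 < J_norm x"
  using Jn_posdef by (simp add: J_norm_eq Jn.posdef_on_def)

lemma form_dist_J_inner: "form_dist J_inner x y = J_norm (x - y)"
  by (simp add: form_dist_def J_norm_def)

lemma J_norm_diff_commute: "J_norm (x - y) = J_norm (y - x)"
  by (simp add: J_norm_eq Jn.q_diff_commute)

lemma Metric_space_J: "Metric_space UNIV (form_dist J_inner)"
proof
  fix x y z
  show "0 \<le> form_dist J_inner x y" "form_dist J_inner x y = form_dist J_inner y x"
    by (simp_all add: form_dist_J_inner J_norm_eq Jn_q_nonneg Jn.q_diff_commute[of x])
  show "form_dist J_inner x y = 0 \<longleftrightarrow> x = y"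
    using J_norm_pos[of "x - y"] by (cases "x = y") (auto simp: form_dist_J_inner J_norm_eq)
  show "form_dist J_inner x z \<le> form_dist J_inner x y + form_dist J_inner y z"
    using Jn.sqrt_q_triangle[OF Jn_posdef, of "x - y" "y - z"]
    by (simp add: form_dist_J_inner J_norm_eq)
qed

lemma closed_span_iff: "x \<in> closed_span S \<longleftrightarrow> (\<forall>e>0. \<exists>y\<in>span S. J_norm (x - y) < e)"
  unfolding closed_span_def J_topology_def Metric_space.metric_closure_of[OF Metric_space_J]
  by (simp add: Metric_space.in_mball[OF Metric_space_J] form_dist_J_inner)

lemma closed_span_superset: "S \<subseteq> closed_span S"
proof
  fix x assume "x \<in> S"
  then show "x \<in> closed_span S"
    unfolding closed_span_iff by (auto intro!: bexI[of _ x] span_base simp: J_norm_eq)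
qed

lemma closed_span_mono: "S \<subseteq> T \<Longrightarrow> closed_span S \<subseteq> closed_span T"
  unfolding closed_span_def by (intro closure_of_mono span_mono)

text \<open>This brings a vector back into a closed span once its double is known to lie
  there.\<close>

lemma closed_span_scale:
  assumes "x \<in> closed_span S"
  shows "smul c x \<in> closed_span S"
  unfolding closed_span_iff
proof (intro allI impI)
  fix e :: real assume "e > 0"
  then have "e / (norm c + 1) > 0" by (simp add: add_nonneg_pos)
  then obtain y where y: "y \<in> span S" "J_norm (x - y) < e / (norm c + 1)"
    using assms unfolding closed_span_iff by blast
  have "J_norm (smul c x - smul c y) = norm c * J_norm (x - y)"
    by (simp add: J_norm_smul flip: scale_right_diff_distrib)
  also have "\<dots> \<le> (norm c + 1) * J_norm (x - y)"
    by (simp add: J_norm_eq Jn_q_nonneg mult_right_mono)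
  also have "\<dots> < e"
    using y(2) by (simp add: pos_less_divide_eq add_nonneg_pos mult.commute)
  finally show "\<exists>z\<in>span S. J_norm (smul c x - z) < e"
    using span_scale[OF y(1)] by blast
qed

text \<open>The absolute value lets the same approximation serve the form and its negative.\<close>

lemma closed_span_approx:
  assumes "x \<in> closed_span S" "e > 0"
  shows "\<exists>y\<in>span S. \<bar>fm.q (x - y)\<bar> < e"
proof -
  obtain y where y: "y \<in> span S" "J_norm (x - y) < sqrt e"
    using assms unfolding closed_span_iff by (meson real_sqrt_gt_zero)
  then have "Jn.q (x - y) < e" by (simp add: J_norm_eq)
  then show ?thesis using y(1) abs_q_le_Jn_q[of "x - y"] by (meson le_less_trans)
qed

lemma unif_J_positive_posdef: "unif_J_positive N \<Longrightarrow> fm.posdef_on N"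
  unfolding unif_J_positive_def fm.posdef_on_def fm.q_def
  using J_norm_pos by (meson less_le_trans mult_pos_pos zero_less_power)

lemma unif_J_negative_posdef: "unif_J_negative N \<Longrightarrow> neg.posdef_on N"
  unfolding unif_J_negative_def neg.posdef_on_def neg.q_def re_minus
  using J_norm_pos by (meson less_le_trans mult_pos_pos zero_less_power)

section \<open>The synthesis operator and the removal of one member\<close>

lemma synthesis_remove:
  assumes "c n = 0"
  shows "synthesis (I - {n}) f c = synthesis I f c"
proof -
  have drop: "(\<Sum>i\<in>F - {n}. smul (c i) (f i)) = (\<Sum>i\<in>F. smul (c i) (f i))" if "finite F" for F
    using that assms by (intro sum.mono_neutral_left) auto
  \<comment> \<open>Both nets of partial sums are eventually in the same sets, so they have the same
    limits and the two descriptions by \<open>THE\<close> agree, also for a divergent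
    series.\<close>
  have "eventually (\<lambda>F. (\<Sum>i\<in>F. smul (c i) (f i)) \<in> U) (finite_subsets_at_top (I - {n})) \<longleftrightarrow>
        eventually (\<lambda>F. (\<Sum>i\<in>F. smul (c i) (f i)) \<in> U) (finite_subsets_at_top I)" (is "?l \<longleftrightarrow> ?r") for U
  proof
    assume ?l
    then obtain X where "finite X \<and> X \<subseteq> I - {n} \<and>
        (\<forall>Y. finite Y \<and> X \<subseteq> Y \<and> Y \<subseteq> I - {n} \<longrightarrow> (\<Sum>i\<in>Y. smul (c i) (f i)) \<in> U)"
      unfolding eventually_finite_subsets_at_top ..
    then have X: "finite X" "X \<subseteq> I - {n}"
      "finite Y \<Longrightarrow> X \<subseteq> Y \<Longrightarrow> Y \<subseteq> I - {n} \<Longrightarrow> (\<Sum>i\<in>Y. smul (c i) (f i)) \<in> U" for Y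
      by simp_all
    have "(\<Sum>i\<in>Y. smul (c i) (f i)) \<in> U" if "finite Y" "X \<subseteq> Y" "Y \<subseteq> I" for Y
      unfolding drop[OF that(1), symmetric] by (rule X(3)) (use X(2) that in auto)
    then show ?r
      unfolding eventually_finite_subsets_at_top using X by blast
  next
    assume ?r
    then obtain X where "finite X \<and> X \<subseteq> I \<and>
        (\<forall>Y. finite Y \<and> X \<subseteq> Y \<and> Y \<subseteq> I \<longrightarrow> (\<Sum>i\<in>Y. smul (c i) (f i)) \<in> U)"
      unfolding eventually_finite_subsets_at_top ..
    then have X: "finite X" "X \<subseteq> I"
      "finite Y \<Longrightarrow> X \<subseteq> Y \<Longrightarrow> Y \<subseteq> I \<Longrightarrow> (\<Sum>i\<in>Y. smul (c i) (f i)) \<in> U" for Y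
      by simp_all
    \<comment> \<open>\<open>X\<close> may contain \<open>n\<close>, which \<open>Y\<close> may not;
      passing to \<open>X \<union> Y\<close> restores it without changing the sum.\<close>
    have "(\<Sum>i\<in>Y. smul (c i) (f i)) \<in> U" if Y: "finite Y" "X - {n} \<subseteq> Y" "Y \<subseteq> I - {n}" for Y
    proof -
      have "(\<Sum>i\<in>X \<union> Y. smul (c i) (f i)) \<in> U"
        by (rule X(3)) (use X(1,2) Y in auto)
      moreover have "(X \<union> Y) - {n} = Y" using Y by blast
      ultimately show ?thesis
        using drop[of "X \<union> Y"] X(1) Y(1) by simp
    qed
    then show ?l
      unfolding eventually_finite_subsets_at_top using X(1,2)
      by (intro exI[of _ "X - {n}"]) auto
  qed
  then show ?thesis
    by (simp add: synthesis_def limitin_def)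
qed

text \<open>A coefficient family on \<open>I - {n}\<close> already vanishes at \<open>n\<close>, so
  it is also one on \<open>I\<close> and synthesises the same vector. Maximality later upgrades this
  inclusion to an equality.\<close>

lemma synthesis_range_remove:
  "(\<lambda>c. synthesis (I - {n}) f (coord_proj (S - {n}) c)) ` ell2 (I - {n})
    \<subseteq> (\<lambda>c. synthesis I f (coord_proj S c)) ` ell2 I"
proof (rule image_subsetI)
  fix c assume c: "c \<in> ell2 (I - {n})"
  then have "c n = 0" by (auto simp: ell2_def)
  then have eq: "coord_proj (S - {n}) c = coord_proj S c"
    by (auto simp: coord_proj_def)
  have "(\<lambda>i. (norm (c i))\<^sup>2) summable_on I \<longleftrightarrow> (\<lambda>i. (norm (c i))\<^sup>2) summable_on (I - {n})"
    by (rule summable_on_cong_neutral) (use \<open>c n = 0\<close> in auto)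
  then have "c \<in> ell2 I" using c by (auto simp: ell2_def)
  moreover have "synthesis (I - {n}) f (coord_proj (S - {n}) c) = synthesis I f (coord_proj S c)"
    unfolding eq using \<open>c n = 0\<close> by (intro synthesis_remove) (simp add: coord_proj_def)
  ultimately show "synthesis (I - {n}) f (coord_proj (S - {n}) c)
      \<in> (\<lambda>c. synthesis I f (coord_proj S c)) ` ell2 I" by blast
qed

lemma limitin_J_unique:
  "limitin J_topology u x F \<Longrightarrow> limitin J_topology u y F \<Longrightarrow> F \<noteq> bot \<Longrightarrow> x = y"
  unfolding J_topology_def
  by (rule limitin_Hausdorff_unique[OF _ _ _ Metric_space.Hausdorff_space_mtopology[OF Metric_space_J]])

lemma in_synthesis_range:
  assumes n: "n \<in> I" "n \<in> S"
  shows "f n \<in> (\<lambda>c. synthesis I f (coord_proj S c)) ` ell2 I"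
proof -
  \<comment> \<open>The unit coordinate vector at \<open>n\<close>; its partial sums equal
    \<open>f n\<close> as soon as they include that index.\<close>
  define d :: "_ \<Rightarrow> 'k" where "d i = (if i = n then 1 else 0)" for i
  have "(\<lambda>i. (norm (d i))\<^sup>2) summable_on I \<longleftrightarrow> (\<lambda>i. (norm (d i))\<^sup>2) summable_on {n}"
    by (rule summable_on_cong_neutral) (use n in \<open>auto simp: d_def\<close>)
  then have d: "d \<in> ell2 I" using n by (auto simp: ell2_def d_def)
  have "coord_proj S d = d" using n by (auto simp: coord_proj_def d_def)
  moreover have "synthesis I f d = f n"
    unfolding synthesis_def
  proof (rule the_equality)
    have "eventually (\<lambda>F. f n = (\<Sum>i\<in>F. smul (d i) (f i))) (finite_subsets_at_top I)"
      unfolding eventually_finite_subsets_at_top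
      using n by (intro exI[of _ "{n}"])
        (auto simp: d_def if_distrib[of "\<lambda>c. smul c _"] cong: if_cong)
    moreover have "limitin J_topology (\<lambda>F. f n) (f n) (finite_subsets_at_top I)"
      by (simp add: limitin_const_iff J_topology_def Metric_space.topspace_mtopology[OF Metric_space_J])
    ultimately show lim: "limitin J_topology (\<lambda>F. \<Sum>i\<in>F. smul (d i) (f i)) (f n) (finite_subsets_at_top I)"
      by (rule limitin_transform_eventually)
    show "x = f n" if "limitin J_topology (\<lambda>F. \<Sum>i\<in>F. smul (d i) (f i)) x (finite_subsets_at_top I)" for x
      using limitin_J_unique[OF that lim] by simp
  qed
  ultimately show ?thesis using d by force
qed

text \<open>If the series converges, its unique limit is approximated by partial sums in the span.
  If not, the predicate under \<open>THE\<close> is identically false, which singles out one fixed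
  unspecified vector.\<close>

lemma synthesis_in_closed_span_or_junk:
  assumes c: "\<And>i. i \<notin> S \<Longrightarrow> c i = 0"
  shows "synthesis I f c \<in> closed_span (f ` S) \<or> synthesis I f c = (THE x. False)"
proof (cases "\<exists>x. limitin J_topology (\<lambda>F. \<Sum>i\<in>F. smul (c i) (f i)) x (finite_subsets_at_top I)")
  case True
  then obtain x where x: "limitin J_topology (\<lambda>F. \<Sum>i\<in>F. smul (c i) (f i)) x (finite_subsets_at_top I)"
    by blast
  then have "synthesis I f c = x"
    unfolding synthesis_def by (auto intro!: the_equality dest: limitin_J_unique)
  moreover have "x \<in> closed_span (f ` S)"
    unfolding closed_span_iff
  proof (intro allI impI)
    fix e :: real assume "e > 0"
    then have "eventually (\<lambda>F. J_norm (x - (\<Sum>i\<in>F. smul (c i) (f i))) < e) (finite_subsets_at_top I)"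
      using x unfolding J_topology_def Metric_space.limitin_metric[OF Metric_space_J]
      by (simp add: form_dist_J_inner J_norm_diff_commute[of x])
    then obtain F where "J_norm (x - (\<Sum>i\<in>F. smul (c i) (f i))) < e"
      using eventually_happens'[OF finite_subsets_at_top_neq_bot] by blast
    moreover have "(\<Sum>i\<in>F. smul (c i) (f i)) \<in> span (f ` S)"
    proof (rule span_sum)
      fix i show "smul (c i) (f i) \<in> span (f ` S)"
        using c[of i] by (cases "i \<in> S") (auto intro: span_scale span_base span_zero)
    qed
    ultimately show "\<exists>y\<in>span (f ` S). J_norm (x - y) < e" by blast
  qed
  ultimately show ?thesis by simp
next
  case False
  then show ?thesis unfolding synthesis_def by simp
qed

text \<open>If the series for \<open>f n\<close> diverged, then \<open>f n\<close> would be the junk value of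
  \<^const>\<open>synthesis\<close>, and \<open>2 f n\<close>, being a different vector, would be a genuine limit.\<close>

lemma in_closed_span_if_in_synthesis_range:
  fixes I f S
  defines "R \<equiv> (\<lambda>c. synthesis I f (coord_proj S c)) ` ell2 I"
  assumes "subspace R" "v \<in> R" "v \<noteq> 0"
  shows "v \<in> closed_span (f ` S)"
proof (rule ccontr)
  assume v: "v \<notin> closed_span (f ` S)"
  have junk: "w \<in> closed_span (f ` S) \<or> w = (THE x. False)" if "w \<in> R" for w
    using that synthesis_in_closed_span_or_junk[of S "coord_proj S _" I f]
    unfolding R_def by (auto simp: coord_proj_def)
  have two: "smul 2 v = v + v"
    using scale_left_distrib[of 1 1 v] by simp
  have "smul 2 v \<noteq> v" using \<open>v \<noteq> 0\<close> unfolding two by simp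
  moreover have "v = (THE x. False)" using junk[OF \<open>v \<in> R\<close>] v by blast
  ultimately have "smul 2 v \<in> closed_span (f ` S)"
    using junk[of "smul 2 v"] subspace_scale[OF \<open>subspace R\<close> \<open>v \<in> R\<close>] by metis
  then have "smul (1 / 2) (smul 2 v) \<in> closed_span (f ` S)" by (rule closed_span_scale)
  then show False using v by simp
qed

lemma I_plus_remove: "I_plus (I - {n}) f = I_plus I f - {n}"
  and I_minus_remove: "I_minus (I - {n}) f = I_minus I f - {n}"
  by (auto simp: I_plus_def I_minus_def)

text \<open>The range of \<open>T_plus\<close> shrinks on removal of \<open>f n\<close>, but the
  smaller range is itself maximal, so the two coincide. The larger one contains \<open>f n\<close>,
  which is therefore synthesised by the remaining members.\<close>

lemma J_frame_remove_plus:
  assumes "J_frame I f" "J_frame (I - {n}) f" "n \<in> I_plus I f" "f n \<noteq> 0"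
  shows "f n \<in> closed_span (f ` (I_plus I f - {n}))"
proof -
  let ?R = "\<lambda>I. T_plus I f ` ell2 I"
  have R: "?R I = (\<lambda>c. synthesis I f (coord_proj (I_plus I f) c)) ` ell2 I" for I
    by (auto simp: T_plus_def)
  have "?R (I - {n}) \<subseteq> ?R I"
    unfolding R I_plus_remove by (rule synthesis_range_remove)
  with assms have "?R I = ?R (I - {n})"
    by (simp add: J_frame_def max_unif_J_positive_def)
  moreover have "f n \<in> ?R I"
    unfolding R using assms(3) by (intro in_synthesis_range) (auto simp: I_plus_def)
  moreover have "subspace (?R (I - {n}))"
    using assms(2) by (simp add: J_frame_def max_unif_J_positive_def unif_J_positive_def)
  ultimately show ?thesis
    using in_closed_span_if_in_synthesis_range[of "I - {n}" f "I_plus I f - {n}" "f n"] assms(4)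
    by (simp add: R I_plus_remove)
qed

text \<open>The same maximality argument for the range of \<open>T_minus\<close>.\<close>

lemma J_frame_remove_minus:
  assumes "J_frame I f" "J_frame (I - {n}) f" "n \<in> I_minus I f" "f n \<noteq> 0"
  shows "f n \<in> closed_span (f ` (I_minus I f - {n}))"
proof -
  let ?R = "\<lambda>I. T_minus I f ` ell2 I"
  have R: "?R I = (\<lambda>c. synthesis I f (coord_proj (I_minus I f) c)) ` ell2 I" for I
    by (auto simp: T_minus_def)
  have "?R (I - {n}) \<subseteq> ?R I"
    unfolding R I_minus_remove by (rule synthesis_range_remove)
  with assms have "?R I = ?R (I - {n})"
    by (simp add: J_frame_def max_unif_J_negative_def)
  moreover have "f n \<in> ?R I"
    unfolding R using assms(3) by (intro in_synthesis_range) (auto simp: I_minus_def)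
  moreover have "subspace (?R (I - {n}))"
    using assms(2) by (simp add: J_frame_def max_unif_J_negative_def unif_J_negative_def)
  ultimately show ?thesis
    using in_closed_span_if_in_synthesis_range[of "I - {n}" f "I_minus I f - {n}" "f n"] assms(4)
    by (simp add: R I_minus_remove)
qed

section \<open>Subsequences of the given family and its two sides\<close>

context
  fixes f :: "nat \<Rightarrow> 'v" and A1 B1 A2 B2 :: real
  assumes nonzero: "\<And>n. f n \<noteq> 0"
    and subseq: "\<And>\<sigma> :: nat \<Rightarrow> nat. strict_mono \<sigma> \<Longrightarrow>
      J_frame_sequence UNIV (f \<circ> \<sigma>) \<and> optimal_J_bounds UNIV (f \<circ> \<sigma>) B2 A2 A1 B1"
begin

text \<open>Every infinite \<open>S\<close> is the range of its increasing enumeration. Reindexing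
  along it replaces subsequences by subsets of the index set, the form in which
  \<open>optimal_family\<close> is stated.\<close>

lemma
  assumes "infinite S"
  shows bij_betw_enumerate_I_plus:
      "bij_betw (enumerate S) (I_plus UNIV (f \<circ> enumerate S)) (I_plus UNIV f \<inter> S)"
    and bij_betw_enumerate_I_minus:
      "bij_betw (enumerate S) (I_minus UNIV (f \<circ> enumerate S)) (I_minus UNIV f \<inter> S)"
    and M_plus_enumerate:
      "M_plus UNIV (f \<circ> enumerate S) = closed_span (f ` (I_plus UNIV f \<inter> S))"
    and M_minus_enumerate:
      "M_minus UNIV (f \<circ> enumerate S) = closed_span (f ` (I_minus UNIV f \<inter> S))"
    and optimal_enumerate: "optimal_J_bounds UNIV (f \<circ> enumerate S) B2 A2 A1 B1"
proof -
  let ?s = "enumerate S"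
  have mono: "strict_mono ?s" using assms by (rule strict_mono_enumerate)
  have "range ?s = S" using assms by (rule range_enumerate)
  then have img: "?s ` I_plus UNIV (f \<circ> ?s) = I_plus UNIV f \<inter> S"
    "?s ` I_minus UNIV (f \<circ> ?s) = I_minus UNIV f \<inter> S"
    by (auto simp: I_plus_def I_minus_def)
  have inj: "inj ?s" using mono by (rule strict_mono_imp_inj_on)
  show "optimal_J_bounds UNIV (f \<circ> ?s) B2 A2 A1 B1" using subseq[OF mono] by blast
  show "bij_betw ?s (I_plus UNIV (f \<circ> ?s)) (I_plus UNIV f \<inter> S)"
    "bij_betw ?s (I_minus UNIV (f \<circ> ?s)) (I_minus UNIV f \<inter> S)"
    using img inj by (auto simp: bij_betw_def intro: inj_on_subset)
  show "M_plus UNIV (f \<circ> ?s) = closed_span (f ` (I_plus UNIV f \<inter> S))"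
    "M_minus UNIV (f \<circ> ?s) = closed_span (f ` (I_minus UNIV f \<inter> S))"
    unfolding M_plus_def M_minus_def image_comp[symmetric] img by simp_all
qed

lemma closed_span_ne_zero:
  assumes "A \<noteq> {}"
  shows "closed_span (f ` A) \<noteq> {0}"
  using closed_span_superset[of "f ` A"] assms nonzero by auto

text \<open>\<open>I_plus\<close> admits neutral members while the definition of a
  \<open>J\<close>-frame sequence asks for strict positivity. The two agree because the members are
  nonzero and the family, as a subsequence of itself, has no nonzero neutral elements.\<close>

lemma I_plus_eq: "I_plus UNIV f = {i. re (form (f i) (f i)) > 0}"
proof -
  have "form (f i) (f i) \<noteq> 0" for i
    using subseq[of id] nonzero[of i] by (auto simp: J_frame_sequence_def strict_mono_def)
  then have "fm.q (f i) \<noteq> 0" for i using fm.g_self[of "f i"] by auto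
  then show ?thesis by (auto simp: I_plus_def fm.q_def less_le dest: sym)
qed

lemma optimal_family_plus:
  "optimal_family smul form (closed_span (f ` I_plus UNIV f)) (I_plus UNIV f) f closed_span A1 B1"
proof unfold_locales
  let ?P = "I_plus UNIV f"
  have "unif_J_positive (closed_span (f ` ?P))"
    using subseq[of id] unfolding I_plus_eq by (auto simp: J_frame_sequence_def strict_mono_def)
  then show "fm.posdef_on (closed_span (f ` ?P))" by (rule unif_J_positive_posdef)
  show "f i \<in> closed_span (f ` ?P)" if "i \<in> ?P" for i
    using closed_span_superset that by blast
  show "f i \<noteq> 0" for i by (rule nonzero)
  show "T \<subseteq> closed_span T" for T by (rule closed_span_superset)
  show "closed_span T \<subseteq> closed_span (f ` ?P)" if "T \<subseteq> f ` ?P" for T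
    using that by (rule closed_span_mono)
  show "\<exists>y\<in>span T. fm.q (x - y) < e" if "x \<in> closed_span T" "e > 0" for T x e
    using closed_span_approx[OF that] by (meson abs_ge_self le_less_trans)
  have id: "has_J_bounds UNIV (f \<circ> id) B2 A2 A1 B1"
    using subseq[of id] by (simp add: optimal_J_bounds_def strict_mono_def)
  then show "0 < A1" "A1 \<le> B1" by (simp_all add: has_J_bounds_def)
  fix S :: "nat set" assume S: "infinite S"
  define \<sigma> where "\<sigma> = enumerate S"
  note bij = bij_betw_enumerate_I_plus[OF S, folded \<sigma>_def]
    and M = M_plus_enumerate[OF S, folded \<sigma>_def]
    and opt = optimal_enumerate[OF S, folded \<sigma>_def]
  have sum: "(\<Sum>\<^sub>\<infinity>i\<in>I_plus UNIV (f \<circ> \<sigma>). (norm (form x ((f \<circ> \<sigma>) i)))\<^sup>2)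
      = (\<Sum>\<^sub>\<infinity>i\<in>?P \<inter> S. (norm (form x (f i)))\<^sup>2)" for x
    using infsum_reindex_bij_betw[OF bij, of "\<lambda>i. (norm (form x (f i)))\<^sup>2"] by simp
  note defs = lower_plus_def upper_plus_def M sum fm.q_def
  show "A1 * fm.q x \<le> (\<Sum>\<^sub>\<infinity>i\<in>?P \<inter> S. (norm (form x (f i)))\<^sup>2)"
    "(\<Sum>\<^sub>\<infinity>i\<in>?P \<inter> S. (norm (form x (f i)))\<^sup>2) \<le> B1 * fm.q x"
    if "x \<in> closed_span (f ` (?P \<inter> S))" for x
    using opt that unfolding optimal_J_bounds_def has_J_bounds_def defs by auto
  \<comment> \<open>Optimality is guaranteed only on a nontrivial side; a nonzero member with index
    in \<open>?P \<inter> S\<close> provides this.\<close>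
  assume "?P \<inter> S \<noteq> {}"
  then have "M_plus UNIV (f \<circ> \<sigma>) \<noteq> {0}" unfolding M by (rule closed_span_ne_zero)
  with opt have optimal: "\<forall>a>0. lower_plus UNIV (f \<circ> \<sigma>) a \<longrightarrow> a \<le> A1"
    "\<forall>b>0. upper_plus UNIV (f \<circ> \<sigma>) b \<longrightarrow> B1 \<le> b"
    by (simp_all add: optimal_J_bounds_def)
  show "a' \<le> A1" if "a' > 0" "\<And>x. x \<in> closed_span (f ` (?P \<inter> S)) \<Longrightarrow>
      a' * fm.q x \<le> (\<Sum>\<^sub>\<infinity>i\<in>?P \<inter> S. (norm (form x (f i)))\<^sup>2)" for a'
  proof -
    have "lower_plus UNIV (f \<circ> \<sigma>) a'" using that(2) unfolding defs by blast
    then show ?thesis using optimal that(1) by simp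
  qed
  show "B1 \<le> b'" if "b' > 0" "\<And>x. x \<in> closed_span (f ` (?P \<inter> S)) \<Longrightarrow>
      (\<Sum>\<^sub>\<infinity>i\<in>?P \<inter> S. (norm (form x (f i)))\<^sup>2) \<le> b' * fm.q x" for b'
  proof -
    have "upper_plus UNIV (f \<circ> \<sigma>) b'" using that(2) unfolding defs by blast
    then show ?thesis using optimal that(1) by simp
  qed
qed

text \<open>Negating the form and the constants leaves each product in the frame inequalities
  unchanged, while \<open>B2 \<le> A2 < 0\<close> becomes \<open>0 < - A2 \<le> - B2\<close>. Thus
  lower bounds remain lower bounds.\<close>

lemma optimal_family_minus:
  "optimal_family smul (\<lambda>x y. - form x y) (closed_span (f ` I_minus UNIV f)) (I_minus UNIV f) f
    closed_span (- A2) (- B2)"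
proof unfold_locales
  let ?P = "I_minus UNIV f"
  have "unif_J_negative (closed_span (f ` ?P))"
    using subseq[of id] by (auto simp: I_minus_def J_frame_sequence_def strict_mono_def)
  then show "neg.posdef_on (closed_span (f ` ?P))" by (rule unif_J_negative_posdef)
  show "f i \<in> closed_span (f ` ?P)" if "i \<in> ?P" for i
    using closed_span_superset that by blast
  show "f i \<noteq> 0" for i by (rule nonzero)
  show "T \<subseteq> closed_span T" for T by (rule closed_span_superset)
  show "closed_span T \<subseteq> closed_span (f ` ?P)" if "T \<subseteq> f ` ?P" for T
    using that by (rule closed_span_mono)
  show "\<exists>y\<in>span T. neg.q (x - y) < e" if "x \<in> closed_span T" "e > 0" for T x e
    using closed_span_approx[OF that] unfolding neg_q by (meson abs_ge_minus_self le_less_trans)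
  have id: "has_J_bounds UNIV (f \<circ> id) B2 A2 A1 B1"
    using subseq[of id] by (simp add: optimal_J_bounds_def strict_mono_def)
  then show "0 < - A2" "- A2 \<le> - B2" by (simp_all add: has_J_bounds_def)
  fix S :: "nat set" assume S: "infinite S"
  define \<sigma> where "\<sigma> = enumerate S"
  note bij = bij_betw_enumerate_I_minus[OF S, folded \<sigma>_def]
    and M = M_minus_enumerate[OF S, folded \<sigma>_def]
    and opt = optimal_enumerate[OF S, folded \<sigma>_def]
  have sum: "(\<Sum>\<^sub>\<infinity>i\<in>I_minus UNIV (f \<circ> \<sigma>). (norm (form x ((f \<circ> \<sigma>) i)))\<^sup>2)
      = (\<Sum>\<^sub>\<infinity>i\<in>?P \<inter> S. (norm (form x (f i)))\<^sup>2)" for x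
    using infsum_reindex_bij_betw[OF bij, of "\<lambda>i. (norm (form x (f i)))\<^sup>2"] by simp
  note defs = lower_minus_def upper_minus_def M sum
  have neg: "c * neg.q x = (- c) * re (form x x)" for c x by (simp add: neg.q_def re_minus)
  show "- A2 * neg.q x \<le> (\<Sum>\<^sub>\<infinity>i\<in>?P \<inter> S. (norm (- form x (f i)))\<^sup>2)"
    "(\<Sum>\<^sub>\<infinity>i\<in>?P \<inter> S. (norm (- form x (f i)))\<^sup>2) \<le> - B2 * neg.q x"
    if "x \<in> closed_span (f ` (?P \<inter> S))" for x
    using opt that unfolding optimal_J_bounds_def has_J_bounds_def defs neg by auto
  assume "?P \<inter> S \<noteq> {}"
  then have "M_minus UNIV (f \<circ> \<sigma>) \<noteq> {0}" unfolding M by (rule closed_span_ne_zero)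
  with opt have optimal: "\<forall>a<0. lower_minus UNIV (f \<circ> \<sigma>) a \<longrightarrow> \<bar>a\<bar> \<le> \<bar>A2\<bar>"
    "\<forall>b<0. upper_minus UNIV (f \<circ> \<sigma>) b \<longrightarrow> \<bar>B2\<bar> \<le> \<bar>b\<bar>"
    by (simp_all add: optimal_J_bounds_def)
  show "a' \<le> - A2" if "a' > 0" "\<And>x. x \<in> closed_span (f ` (?P \<inter> S)) \<Longrightarrow>
      a' * neg.q x \<le> (\<Sum>\<^sub>\<infinity>i\<in>?P \<inter> S. (norm (- form x (f i)))\<^sup>2)" for a'
  proof -
    have "lower_minus UNIV (f \<circ> \<sigma>) (- a')"
      using that(2) unfolding defs neg norm_minus_cancel by blast
    moreover have "- a' < 0" using that(1) by simp
    ultimately have "\<bar>- a'\<bar> \<le> \<bar>A2\<bar>" using optimal by blast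
    then show ?thesis using that(1) id by (simp add: has_J_bounds_def)
  qed
  show "- B2 \<le> b'" if "b' > 0" "\<And>x. x \<in> closed_span (f ` (?P \<inter> S)) \<Longrightarrow>
      (\<Sum>\<^sub>\<infinity>i\<in>?P \<inter> S. (norm (- form x (f i)))\<^sup>2) \<le> b' * neg.q x" for b'
  proof -
    have "upper_minus UNIV (f \<circ> \<sigma>) (- b')"
      using that(2) unfolding defs neg norm_minus_cancel by blast
    moreover have "- b' < 0" using that(1) by simp
    ultimately have "\<bar>B2\<bar> \<le> \<bar>- b'\<bar>" using optimal by blast
    then show ?thesis using that(1) id by (simp add: has_J_bounds_def)
  qed
qed

text \<open>Survival of the frame property would put \<open>f n\<close> into the closed span of the
  other members of its side, from which orthogonality excludes it.\<close>

lemma not_J_frame_remove: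
  assumes "J_frame UNIV f"
  shows "\<not> J_frame (UNIV - {n}) f"
proof
  assume remove: "J_frame (UNIV - {n}) f"
  consider "n \<in> I_plus UNIV f" | "n \<in> I_minus UNIV f"
    by (fastforce simp: I_plus_def I_minus_def)
  then show False
  proof cases
    case 1
    then show False
      using J_frame_remove_plus[OF assms remove _ nonzero]
        optimal_family.not_in_closed_span_others[OF optimal_family_plus] by blast
  next
    case 2
    then show False
      using J_frame_remove_minus[OF assms remove _ nonzero]
        optimal_family.not_in_closed_span_others[OF optimal_family_minus] by blast
  qed
qed

end

end

theorem theorem3p13:
  fixes smul :: "'k::real_or_complex \<Rightarrow> 'v::ab_group_add \<Rightarrow> 'v"
    and form :: "'v \<Rightarrow> 'v \<Rightarrow> 'k"
    and Kp Km :: "'v set"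
    and f :: "nat \<Rightarrow> 'v"
    and A1 B1 A2 B2 :: real
  assumes "krein_space smul form Kp Km"
    and "krein_space.J_frame smul form Kp Km UNIV f"
    and "krein_space.optimal_J_bounds smul form Kp Km UNIV f B2 A2 A1 B1"
    and "\<And>n. f n \<noteq> 0"
    and "\<And>\<sigma> :: nat \<Rightarrow> nat. strict_mono \<sigma> \<Longrightarrow>
           krein_space.J_frame_sequence smul form Kp Km UNIV (f \<circ> \<sigma>) \<and>
           krein_space.optimal_J_bounds smul form Kp Km UNIV (f \<circ> \<sigma>) B2 A2 A1 B1"
  shows "krein_space.exact_J_frame smul form Kp Km UNIV f"
proof -
  interpret krein_space smul form Kp Km by fact
  show ?thesis
    unfolding exact_J_frame_def
    using assms(2) not_J_frame_remove[OF assms(4) assms(5) assms(2)] by blast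
qed

end
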